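(* Let $G$ be a finite group, let $n$ be a positive integer, and let $\mathcal{F}$ be a family of distinct subgroups of $G$, closed under conjugation (i.e. $F^g=g^{-1}Fg\in\mathcal{F}$ for all $F\in\mathcal{F}$ and $g\in G$), such that for every $F\in\mathcal{F}$ the exponent of $F$ divides $n$ and $F$ is $C_n$-cellular. If $S$ is the active sum of $\mathcal{F}$, then $\pi(H_2(S))\subseteq\pi(n)$.
   Context: $C_n$ denotes a (multiplicative) cyclic group of order $n$. For a positive integer $n$, $\pi(n)$ is the set of primes dividing $n$; for a finite group $K$, $\pi(K)=\pi(|K|)$. $H_2(K)=H_2(K,\mathbb{Z})$ denotes the Schur multiplier of a group $K$. Active sum: for a family $\mathcal{F}$ of distinct subgroups of a group $G$ closed under conjugation, the active sum $S$ of $\mathcal{F}$ is the quotient of the free product $\amalg_{F\in\mathcal{F}}F$ of the groups in $\mathcal{F}$ by the normal subgroup generated by all elements of the form $h^{-1}\cdot g\cdot h\cdot (g^h)^{-1}$ with $h\in F_1$, $g\in F_2$, $F_1,F_2\in\mathcal{F}$. Here the products are taken in the free product ($h$ in the factor $F_1$, $g$ in the factor $F_2$), while $g^h=h^{-1}gh$ is the conjugate computed in $G$, regarded as an element of the factor $F_2^h=h^{-1}F_2h\in\mathcal{F}$. If $G$ is finite, then $S$ is finite. Cellularity: for a group $A$, a group homomorphism $f:X\to Y$ is an $A$-equivalence if the map $\mathrm{Hom}(A,f):\mathrm{Hom}(A,X)\to\mathrm{Hom}(A,Y)$, $t\mapsto f\circ t$, is a bijection. A group $H$ is $A$-cellular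 if every $A$-equivalence $f:X\to Y$ (for arbitrary groups $X,Y$) is also an $H$-equivalence. *)

theory Defs
  imports "HOL-Algebra.Free_Abelian_Groups" "HOL-Computational_Algebra.Primes"
begin

(* With the convention that an infinite group has order 0, an infinite group has
   pi_group equal to the set of all primes. *)
definition prime_divisors :: "nat \<Rightarrow> nat set" where
  "prime_divisors n = {p. prime p \<and> p dvd n}"

definition pi_group :: "('a, 'b) monoid_scheme \<Rightarrow> nat set" where
  "pi_group G = prime_divisors (order G)"

definition group_exponent :: "('a, 'b) monoid_scheme \<Rightarrow> nat" where
  "group_exponent G = (LEAST m. 0 < m \<and> (\<forall>x\<in>carrier G. x [^]\<^bsub>G\<^esub> m = \<one>\<^bsub>G\<^esub>))"

(* conj_elem G g h is g^h. *)
definition conj_elem :: "('a, 'b) monoid_scheme \<Rightarrow> 'a \<Rightarrow> 'a \<Rightarrow> 'a" where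
  "conj_elem G g h = inv\<^bsub>G\<^esub> h \<otimes>\<^bsub>G\<^esub> g \<otimes>\<^bsub>G\<^esub> h"

definition conj_set :: "('a, 'b) monoid_scheme \<Rightarrow> 'a set \<Rightarrow> 'a \<Rightarrow> 'a set" where
  "conj_set G F h = (\<lambda>g. conj_elem G g h) ` F"

definition conj_closed_family :: "('a, 'b) monoid_scheme \<Rightarrow> 'a set set \<Rightarrow> bool" where
  "conj_closed_family G \<F> \<longleftrightarrow>
     (\<forall>F\<in>\<F>. subgroup F G) \<and> (\<forall>F\<in>\<F>. \<forall>g\<in>carrier G. conj_set G F g \<in> \<F>)"


text \<open>The free product of a family of groups: words in the disjoint union of the carriers,
  modulo the congruence that multiplies adjacent letters of the same factor and deletes
  the identities.\<close>

definition fp_words :: "'i set \<Rightarrow> ('i \<Rightarrow> ('a, 'b) monoid_scheme) \<Rightarrow> ('i \<times> 'a) list set" where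
  "fp_words I K = lists (SIGMA i:I. carrier (K i))"

inductive_set fp_rel ::
    "'i set \<Rightarrow> ('i \<Rightarrow> ('a, 'b) monoid_scheme) \<Rightarrow> (('i \<times> 'a) list \<times> ('i \<times> 'a) list) set"
  for I :: "'i set" and K :: "'i \<Rightarrow> ('a, 'b) monoid_scheme" where
  one: "i \<in> I \<Longrightarrow> ([(i, \<one>\<^bsub>K i\<^esub>)], []) \<in> fp_rel I K"
| mult: "\<lbrakk>i \<in> I; x \<in> carrier (K i); y \<in> carrier (K i)\<rbrakk>
    \<Longrightarrow> ([(i, x), (i, y)], [(i, x \<otimes>\<^bsub>K i\<^esub> y)]) \<in> fp_rel I K"
| refl: "w \<in> fp_words I K \<Longrightarrow> (w, w) \<in> fp_rel I K"
| sym: "(u, v) \<in> fp_rel I K \<Longrightarrow> (v, u) \<in> fp_rel I K"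
| trans: "\<lbrakk>(u, v) \<in> fp_rel I K; (v, w) \<in> fp_rel I K\<rbrakk> \<Longrightarrow> (u, w) \<in> fp_rel I K"
| append: "\<lbrakk>(u, v) \<in> fp_rel I K; (u', v') \<in> fp_rel I K\<rbrakk> \<Longrightarrow> (u @ u', v @ v') \<in> fp_rel I K"

definition free_product ::
    "'i set \<Rightarrow> ('i \<Rightarrow> ('a, 'b) monoid_scheme) \<Rightarrow> ('i \<times> 'a) list set monoid" where
  "free_product I K =
     \<lparr>carrier = fp_words I K // fp_rel I K,
      monoid.mult = (\<lambda>U V. \<Union>u\<in>U. \<Union>v\<in>V. fp_rel I K `` {u @ v}),
      one = fp_rel I K `` {[]}\<rparr>"

definition fp_inj ::
    "'i set \<Rightarrow> ('i \<Rightarrow> ('a, 'b) monoid_scheme) \<Rightarrow> 'i \<Rightarrow> 'a \<Rightarrow> ('i \<times> 'a) list set" where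
  "fp_inj I K i x = fp_rel I K `` {[(i, x)]}"

definition normal_closure :: "('a, 'b) monoid_scheme \<Rightarrow> 'a set \<Rightarrow> 'a set" where
  "normal_closure G R = \<Inter>{N. N \<lhd> G \<and> R \<subseteq> N}"


definition family_free_product ::
    "('a, 'b) monoid_scheme \<Rightarrow> 'a set set \<Rightarrow> ('a set \<times> 'a) list set monoid" where
  "family_free_product G \<F> = free_product \<F> (\<lambda>F. G\<lparr>carrier := F\<rparr>)"

definition family_inj ::
    "('a, 'b) monoid_scheme \<Rightarrow> 'a set set \<Rightarrow> 'a set \<Rightarrow> 'a \<Rightarrow> ('a set \<times> 'a) list set" where
  "family_inj G \<F> = fp_inj \<F> (\<lambda>F. G\<lparr>carrier := F\<rparr>)"

definition active_sum_relators ::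
    "('a, 'b) monoid_scheme \<Rightarrow> 'a set set \<Rightarrow> ('a set \<times> 'a) list set set" where
  "active_sum_relators G \<F> =
     {inv\<^bsub>family_free_product G \<F>\<^esub> (family_inj G \<F> F1 h)
        \<otimes>\<^bsub>family_free_product G \<F>\<^esub> family_inj G \<F> F2 g
        \<otimes>\<^bsub>family_free_product G \<F>\<^esub> family_inj G \<F> F1 h
        \<otimes>\<^bsub>family_free_product G \<F>\<^esub>
          inv\<^bsub>family_free_product G \<F>\<^esub> (family_inj G \<F> (conj_set G F2 h) (conj_elem G g h))
      | F1 F2 h g. F1 \<in> \<F> \<and> F2 \<in> \<F> \<and> h \<in> F1 \<and> g \<in> F2}"

definition active_sum ::
    "('a, 'b) monoid_scheme \<Rightarrow> 'a set set \<Rightarrow> ('a set \<times> 'a) list set set monoid" where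
  "active_sum G \<F> =
     family_free_product G \<F> Mod
       normal_closure (family_free_product G \<F>) (active_sum_relators G \<F>)"


text \<open>Functions in \<^const>\<open>hom\<close> are unconstrained outside the carrier, so a homomorphism is
  represented uniquely only by its extensional representative.\<close>

definition Hom_set :: "('a, 'b) monoid_scheme \<Rightarrow> ('c, 'd) monoid_scheme \<Rightarrow> ('a \<Rightarrow> 'c) set" where
  "Hom_set A X = hom A X \<inter> extensional (carrier A)"

definition equivalence_wrt ::
    "('a, 'b) monoid_scheme \<Rightarrow> ('x, 'c) monoid_scheme \<Rightarrow> ('y, 'd) monoid_scheme \<Rightarrow> ('x \<Rightarrow> 'y) \<Rightarrow> bool"
  where
  "equivalence_wrt A X Y f \<longleftrightarrow>
     f \<in> hom X Y \<and> bij_betw (\<lambda>t. compose (carrier A) f t) (Hom_set A X) (Hom_set A Y)"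

text \<open>A quantifier cannot range over the groups of all types, so the test groups \<open>X\<close> and \<open>Y\<close>
  are those whose carrier is a subset of the universe \<open>'u\<close>. Cellularity in the usual sense is
  this property for all \<open>'u\<close>; for an infinite \<open>'u\<close> all finite groups occur, up to isomorphism,
  among these test groups.\<close>

definition cellular ::
    "'u itself \<Rightarrow> ('a, 'b) monoid_scheme \<Rightarrow> ('h, 'c) monoid_scheme \<Rightarrow> bool" where
  "cellular U A H \<longleftrightarrow>
     (\<forall>(X::'u monoid) (Y::'u monoid) f.
        group X \<longrightarrow> group Y \<longrightarrow> equivalence_wrt A X Y f \<longrightarrow> equivalence_wrt H X Y f)"


text \<open>Integral group homology with trivial coefficients, from the inhomogeneous (unnormalised)
  bar complex, with the boundary
  \<open>d [x1|...|xn] = [x2|...|xn] + (\<Sum>i=1..n-1. (-1)^i [x1|...|xi x(i+1)|...|xn])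
     + (-1)^n [x1|...|x(n-1)]\<close>.\<close>

definition bar_chains :: "('a, 'b) monoid_scheme \<Rightarrow> nat \<Rightarrow> ('a list \<Rightarrow>\<^sub>0 int) monoid" where
  "bar_chains G n = free_Abelian_group {xs. length xs = n \<and> set xs \<subseteq> carrier G}"

definition bar_face :: "('a, 'b) monoid_scheme \<Rightarrow> nat \<Rightarrow> 'a list \<Rightarrow> 'a list" where
  "bar_face G i xs =
     (if i = 0 then tl xs
      else if i = length xs then butlast xs
      else take (i - 1) xs @ (xs ! (i - 1) \<otimes>\<^bsub>G\<^esub> xs ! i) # drop (i + 1) xs)"

definition bar_boundary :: "('a, 'b) monoid_scheme \<Rightarrow> ('a list \<Rightarrow>\<^sub>0 int) \<Rightarrow> ('a list \<Rightarrow>\<^sub>0 int)" where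
  "bar_boundary G =
     frag_extend (\<lambda>xs. if xs = [] then 0
       else \<Sum>i\<le>length xs. frag_cmul ((-1) ^ i) (frag_of (bar_face G i xs)))"

definition bar_cycles :: "('a, 'b) monoid_scheme \<Rightarrow> nat \<Rightarrow> ('a list \<Rightarrow>\<^sub>0 int) set" where
  "bar_cycles G n = kernel (bar_chains G n) (bar_chains G (n - 1)) (bar_boundary G)"

definition bar_boundaries :: "('a, 'b) monoid_scheme \<Rightarrow> nat \<Rightarrow> ('a list \<Rightarrow>\<^sub>0 int) set" where
  "bar_boundaries G n = bar_boundary G ` carrier (bar_chains G (n + 1))"

definition group_homology :: "nat \<Rightarrow> ('a, 'b) monoid_scheme \<Rightarrow> ('a list \<Rightarrow>\<^sub>0 int) set monoid" where
  "group_homology n G = ((bar_chains G n)\<lparr>carrier := bar_cycles G n\<rparr>) Mod bar_boundaries G n"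

end

theory Submission
  imports Defs "HOL-Algebra.Sylow" "HOL-Algebra.Multiplicative_Group"
begin

text \<open>
  Let \<open>S\<close> be the active sum and \<open>p\<close> a prime that does not divide \<open>n\<close>. The claim is that \<open>p\<close> does not
  divide the order of \<open>H\<^sub>2(S)\<close>, and the reason is that central extensions of \<open>S\<close> by abelian groups
  of exponent \<open>p\<close> split.

  Let \<open>E \<rightarrow> S\<close> be such an extension. An element of \<open>S\<close> with \<open>n\<close>-th power one has at most one lift to \<open>E\<close>
  with \<open>n\<close>-th power one (\<open>torsion_lift_unique\<close>). Each member \<open>F\<close> of the family has exponent dividing
  \<open>n\<close>, hence order prime to \<open>p\<close>, so \<open>F \<rightarrow> S\<close> lifts to \<open>F \<rightarrow> E\<close> by averaging
  (\<open>two_coboundary_if_coprime\<close>). Uniqueness of lifts shows that these lifts respect the relations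
  \<open>h\<^sup>-\<^sup>1 g h = g\<^sup>h\<close> that define the active sum. By its universal property they define a homomorphism
  \<open>S \<rightarrow> E\<close>, which is a section (\<open>cocycle_on_active_sum_splits\<close>).

  This is applied to the universal cocycle \<open>(x, y) \<mapsto> [x|y]\<close> with values in the 2-chains of the bar
  complex modulo boundaries and modulo \<open>p\<close>-fold chains. Its splitting implies that every 2-cycle
  is \<open>p\<close> times a 2-cycle, up to a boundary (\<open>cycles_divisible_if_splits\<close>), that is
  \<open>H\<^sub>2(S) = p H\<^sub>2(S)\<close>. In a finite abelian group this excludes elements of order \<open>p\<close>, so Cauchy's theorem
  finishes the proof once \<open>H\<^sub>2(S)\<close> is known to be finite.

  For finiteness, \<open>S\<close> is generated by finitely many elements of finite order that form a set
  closed under conjugation, so \<open>S\<close> is finite by Dietzmann's lemma (\<open>finite_if_finite_torsion_generators\<close>). The same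
  averaging argument, applied to \<open>S\<close> itself and the universal cocycle modulo boundaries, shows that
  \<open>|S|\<close> kills \<open>H\<^sub>2(S)\<close>, and a finitely generated abelian group of bounded exponent is finite
  (\<open>finite_homology_2\<close>).
\<close>

section \<open>Words and elements of prime order\<close>

definition list_prod :: "('a, 'b) monoid_scheme \<Rightarrow> 'a list \<Rightarrow> 'a" where
  "list_prod G w = foldr (\<otimes>\<^bsub>G\<^esub>) w \<one>\<^bsub>G\<^esub>"

lemma list_prod_Nil [simp]: "list_prod G [] = \<one>\<^bsub>G\<^esub>"
  and list_prod_Cons [simp]: "list_prod G (x # w) = x \<otimes>\<^bsub>G\<^esub> list_prod G w"
  by (simp_all add: list_prod_def)

lemma (in monoid) list_prod_closed [simp]: "set w \<subseteq> carrier G \<Longrightarrow> list_prod G w \<in> carrier G"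
  by (induction w) auto

lemma (in monoid) list_prod_append:
  "set u \<subseteq> carrier G \<Longrightarrow> set v \<subseteq> carrier G \<Longrightarrow> list_prod G (u @ v) = list_prod G u \<otimes> list_prod G v"
  by (induction u) (auto simp: m_assoc)

lemma hom_list_prod:
  assumes "group G" "group H" "h \<in> hom G H" "set w \<subseteq> carrier G"
  shows "h (list_prod G w) = list_prod H (map h w)"
proof -
  interpret group_hom G H h
    using assms by (simp add: group_hom_def group_hom_axioms_def)
  show ?thesis using assms(4) by (induction w) auto
qed

lemma (in group) conj_elem_closed [simp]:
  "g \<in> carrier G \<Longrightarrow> h \<in> carrier G \<Longrightarrow> conj_elem G g h \<in> carrier G"
  by (simp add: conj_elem_def)

lemma (in group) conj_elem_pow:
  assumes "g \<in> carrier G" "h \<in> carrier G"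
  shows "conj_elem G g h [^] (n::nat) = conj_elem G (g [^] n) h"
proof (induction n)
  case (Suc n)
  have "h \<otimes> (inv h \<otimes> z) = z" if "z \<in> carrier G" for z
    using that assms by (simp add: m_assoc[symmetric])
  with Suc assms show ?case by (simp add: conj_elem_def m_assoc)
qed (use assms in \<open>simp add: conj_elem_def\<close>)

context group
begin

text \<open>Cauchy's theorem: a Sylow argument yields a subgroup of order \<open>p\<close>, and any of its non-trivial
  elements will do.\<close>

lemma exists_element_of_prime_order:
  assumes "finite (carrier G)" "prime p" "p dvd order G"
  obtains x where "x \<in> carrier G" "x \<noteq> \<one>" "x [^] p = \<one>"
proof -
  obtain m where "order G = p ^ 1 * m" using assms by auto
  from sylow_thm[OF assms(2) is_group this assms(1)]
  obtain H where H: "subgroup H G" "card H = p" by auto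
  interpret H: group "G\<lparr>carrier := H\<rparr>"
    using H is_group by (simp add: subgroup.subgroup_is_group)
  have "\<not> H \<subseteq> {\<one>}"
    using H(2) assms(2) card_mono[of "{\<one>}" H] prime_gt_1_nat[of p] by auto
  then obtain x where x: "x \<in> H" "x \<noteq> \<one>" by blast
  have "x [^]\<^bsub>G\<lparr>carrier := H\<rparr>\<^esub> order (G\<lparr>carrier := H\<rparr>) = \<one>"
    using H.pow_order_eq_1[of x] x by simp
  then have "x [^] p = \<one>"
    using H by (simp add: order_def nat_pow_consistent[symmetric])
  then show thesis using that x H subgroup.mem_carrier by metis
qed

lemma pow_eq_one_if_exponent_dvd:
  assumes fin: "finite (carrier G)" and dvd: "group_exponent G dvd n" and x: "x \<in> carrier G"
  shows "x [^] n = \<one>"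
proof -
  have "0 < order G \<and> (\<forall>x\<in>carrier G. x [^] order G = \<one>)"
    using fin by (simp add: order_gt_0_iff_finite pow_order_eq_1)
  from LeastI[of "\<lambda>m. 0 < m \<and> (\<forall>x\<in>carrier G. x [^] m = \<one>)", OF this]
  have "x [^] group_exponent G = \<one>" using x by (simp add: group_exponent_def)
  then show ?thesis using x dvd pow_eq_id dvd_trans by metis
qed

text \<open>On a finite group a surjective \<open>p\<close>-th power map is injective, whereas an element of order \<open>p\<close>
  would share its power with the identity.\<close>

lemma prime_not_dvd_order_if_divisible:
  assumes fin: "finite (carrier G)" and p: "prime p"
    and div: "\<And>x. x \<in> carrier G \<Longrightarrow> \<exists>y\<in>carrier G. x = y [^] (p::nat)"
  shows "\<not> p dvd order G"
proof
  assume "p dvd order G"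
  then obtain x where x: "x \<in> carrier G" "x \<noteq> \<one>" "x [^] p = \<one>"
    using exists_element_of_prime_order[OF fin p] by blast
  have "carrier G \<subseteq> (\<lambda>y. y [^] p) ` carrier G" using div by blast
  then have "inj_on (\<lambda>y. y [^] p) (carrier G)"
    using fin by (intro finite_surj_inj) auto
  from inj_onD[OF this, of x \<one>] show False using x by simp
qed

end

section \<open>Free products\<close>

locale group_family =
  fixes I :: "'i set" and K :: "'i \<Rightarrow> ('a, 'b) monoid_scheme"
  assumes factor_group: "i \<in> I \<Longrightarrow> group (K i)"
begin

abbreviation fp_class :: "('i \<times> 'a) list \<Rightarrow> ('i \<times> 'a) list set" where
  "fp_class w \<equiv> fp_rel I K `` {w}"

lemma fp_words_append: "u \<in> fp_words I K \<Longrightarrow> v \<in> fp_words I K \<Longrightarrow> u @ v \<in> fp_words I K"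
  by (auto simp: fp_words_def)

lemma fp_rel_words: "(u, v) \<in> fp_rel I K \<Longrightarrow> u \<in> fp_words I K \<and> v \<in> fp_words I K"
proof (induction rule: fp_rel.induct)
  case (one i)
  interpret group "K i" using one by (rule factor_group)
  show ?case using one by (auto simp: fp_words_def)
next
  case (mult i x y)
  interpret group "K i" using mult by (simp add: factor_group)
  show ?case using mult by (auto simp: fp_words_def)
qed (auto simp: fp_words_def)

lemma equiv_fp_rel: "equiv (fp_words I K) (fp_rel I K)"
proof (rule equivI)
  show "fp_rel I K \<subseteq> fp_words I K \<times> fp_words I K"
    using fp_rel_words by auto
  show "refl_on (fp_words I K) (fp_rel I K)"
    by (auto intro: refl_onI fp_rel.refl)
  show "sym (fp_rel I K)" by (rule symI) (rule fp_rel.sym)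
  show "trans (fp_rel I K)" by (rule transI) (rule fp_rel.trans)
qed

lemma fp_class_eq: "(u, v) \<in> fp_rel I K \<Longrightarrow> fp_class u = fp_class v"
  using equiv_class_eq[OF equiv_fp_rel] .

lemma carrier_free_product: "carrier (free_product I K) = fp_class ` fp_words I K"
  by (auto simp: free_product_def quotient_def)

lemma fp_class_carrier [simp]:
  "w \<in> fp_words I K \<Longrightarrow> fp_class w \<in> carrier (free_product I K)"
  by (auto simp: carrier_free_product)

lemma one_free_product: "\<one>\<^bsub>free_product I K\<^esub> = fp_class []"
  by (simp add: free_product_def)

lemma mult_free_product:
  assumes "u \<in> fp_words I K" "v \<in> fp_words I K"
  shows "fp_class u \<otimes>\<^bsub>free_product I K\<^esub> fp_class v = fp_class (u @ v)"
proof -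
  have "fp_class (u' @ v') = fp_class (u @ v)" if "u' \<in> fp_class u" "v' \<in> fp_class v" for u' v'
  proof -
    have "(u @ v, u' @ v') \<in> fp_rel I K"
      using that by (simp add: fp_rel.append)
    from fp_class_eq[OF this] show ?thesis by (rule HOL.sym)
  qed
  then have "(\<Union>u'\<in>fp_class u. \<Union>v'\<in>fp_class v. fp_class (u' @ v'))
      = (\<Union>u'\<in>fp_class u. \<Union>v'\<in>fp_class v. fp_class (u @ v))"
    by (intro SUP_cong) (rule HOL.refl | assumption)+
  moreover have "fp_class u \<noteq> {}" "fp_class v \<noteq> {}"
    using equiv_class_self[OF equiv_fp_rel] assms by blast+
  ultimately show ?thesis
    unfolding free_product_def by (simp only: monoid.simps UN_constant if_False)
qed

lemma group_free_product: "group (free_product I K)"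
proof (rule groupI)
  have Nil: "[] \<in> fp_words I K" by (simp add: fp_words_def)
  show "\<one>\<^bsub>free_product I K\<^esub> \<in> carrier (free_product I K)"
    using Nil by (simp add: one_free_product)
  fix U assume "U \<in> carrier (free_product I K)"
  then obtain u where u: "u \<in> fp_words I K" "U = fp_class u"
    by (auto simp: carrier_free_product)
  show "\<one>\<^bsub>free_product I K\<^esub> \<otimes>\<^bsub>free_product I K\<^esub> U = U"
    using u Nil by (simp add: one_free_product mult_free_product)
  have "\<exists>v\<in>fp_words I K. (v @ u, []) \<in> fp_rel I K"
    using u(1)
  proof (induction u)
    case Nil
    then show ?case by (auto intro: fp_rel.refl)
  next
    case (Cons l u)
    obtain i x where l: "l = (i, x)" by (cases l)
    from Cons have i: "i \<in> I" and x: "x \<in> carrier (K i)" and u: "u \<in> fp_words I K"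
      by (auto simp: fp_words_def l)
    interpret K: group "K i" using i by (rule factor_group)
    obtain v where v: "v \<in> fp_words I K" "(v @ u, []) \<in> fp_rel I K"
      using Cons u by auto
    let ?y = "inv\<^bsub>K i\<^esub> x"
    have "([(i, ?y), (i, x)], [(i, ?y \<otimes>\<^bsub>K i\<^esub> x)]) \<in> fp_rel I K"
      using i x by (intro fp_rel.mult) auto
    moreover have "?y \<otimes>\<^bsub>K i\<^esub> x = \<one>\<^bsub>K i\<^esub>" using x by simp
    ultimately have "([(i, ?y), (i, x)], []) \<in> fp_rel I K"
      using fp_rel.one[OF i, of K] fp_rel.trans by metis
    from fp_rel.append[OF fp_rel.append[OF fp_rel.refl[OF v(1)] this] fp_rel.refl[OF u]]
    have "((v @ [(i, ?y), (i, x)]) @ u, v @ u) \<in> fp_rel I K" by simp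
    then have "((v @ [(i, ?y)]) @ (l # u), []) \<in> fp_rel I K"
      using fp_rel.trans[OF _ v(2)] by (simp add: l)
    moreover have "v @ [(i, ?y)] \<in> fp_words I K"
      using v i x by (auto simp: fp_words_def)
    ultimately show ?case by blast
  qed
  then obtain v where "v \<in> fp_words I K" "(v @ u, []) \<in> fp_rel I K" by blast
  then show "\<exists>V\<in>carrier (free_product I K). V \<otimes>\<^bsub>free_product I K\<^esub> U = \<one>\<^bsub>free_product I K\<^esub>"
    using u fp_class_eq
    by (intro bexI[of _ "fp_class v"]) (simp_all only: mult_free_product one_free_product fp_class_carrier)
next
  fix U V assume "U \<in> carrier (free_product I K)" "V \<in> carrier (free_product I K)"
  then show "U \<otimes>\<^bsub>free_product I K\<^esub> V \<in> carrier (free_product I K)"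
    by (auto simp: carrier_free_product mult_free_product fp_words_append)
next
  fix U V W assume "U \<in> carrier (free_product I K)" "V \<in> carrier (free_product I K)"
    "W \<in> carrier (free_product I K)"
  then show "U \<otimes>\<^bsub>free_product I K\<^esub> V \<otimes>\<^bsub>free_product I K\<^esub> W
      = U \<otimes>\<^bsub>free_product I K\<^esub> (V \<otimes>\<^bsub>free_product I K\<^esub> W)"
    by (auto simp: carrier_free_product mult_free_product fp_words_append)
qed

lemma fp_inj_hom:
  assumes "i \<in> I" shows "fp_inj I K i \<in> hom (K i) (free_product I K)"
proof (rule homI)
  fix x assume x: "x \<in> carrier (K i)"
  then show "fp_inj I K i x \<in> carrier (free_product I K)"
    using assms by (simp add: fp_inj_def fp_words_def)
  fix y assume y: "y \<in> carrier (K i)"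
  have "[(i, x)] \<in> fp_words I K" "[(i, y)] \<in> fp_words I K"
    using assms x y by (auto simp: fp_words_def)
  then show "fp_inj I K i (x \<otimes>\<^bsub>K i\<^esub> y) = fp_inj I K i x \<otimes>\<^bsub>free_product I K\<^esub> fp_inj I K i y"
    using fp_class_eq[OF fp_rel.mult[where i = i and x = x and y = y]] assms x y
    by (simp add: fp_inj_def mult_free_product)
qed

text \<open>A class is determined by its letters: this is how statements about generators reach the whole
  free product.\<close>

lemma fp_class_eq_list_prod:
  assumes "w \<in> fp_words I K"
  shows "fp_class w = list_prod (free_product I K) (map (\<lambda>(i, x). fp_inj I K i x) w)"
  using assms
proof (induction w)
  case (Cons l w)
  then have "[l] \<in> fp_words I K" "w \<in> fp_words I K" by (auto simp: fp_words_def)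
  then show ?case
    using Cons mult_free_product[of "[l]" w] by (auto simp: fp_inj_def split: prod.split)
qed (simp add: one_free_product)

text \<open>A word is evaluated letter by letter in the target; each generating relation of the congruence
  preserves the value because the given maps are homomorphisms.\<close>

lemma free_product_universal:
  assumes E: "group E" and \<phi>: "\<And>i. i \<in> I \<Longrightarrow> \<phi> i \<in> hom (K i) E"
  obtains h where "h \<in> hom (free_product I K) E"
    and "\<And>i x. i \<in> I \<Longrightarrow> x \<in> carrier (K i) \<Longrightarrow> h (fp_inj I K i x) = \<phi> i x"
proof -
  interpret E: group E by (rule E)
  define ev where "ev w = list_prod E (map (\<lambda>(i, x). \<phi> i x) w)" for w
  have set: "set (map (\<lambda>(i, x). \<phi> i x) w) \<subseteq> carrier E" if "w \<in> fp_words I K" for w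
    using that \<phi> by (fastforce simp: fp_words_def hom_def)
  have ev_closed: "ev w \<in> carrier E" if "w \<in> fp_words I K" for w
    using set[OF that] by (simp add: ev_def)
  have ev_append: "ev (u @ v) = ev u \<otimes>\<^bsub>E\<^esub> ev v"
    if "u \<in> fp_words I K" "v \<in> fp_words I K" for u v
    using set that by (simp add: ev_def E.list_prod_append)
  have ev_cong: "ev u = ev v" if "(u, v) \<in> fp_rel I K" for u v
    using that
  proof (induction rule: fp_rel.induct)
    case (one i)
    then show ?case
      using hom_one[OF \<phi> factor_group E] by (simp add: ev_def)
  next
    case (mult i x y)
    then have "\<phi> i x \<in> carrier E" "\<phi> i y \<in> carrier E" using \<phi> by (auto simp: hom_def)
    then show ?case
      using mult hom_mult[OF \<phi>[OF mult(1)] mult(2,3)] by (simp add: ev_def E.m_assoc[symmetric])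
  next
    case (append u v u' v')
    then show ?case using fp_rel_words[OF append(1)] fp_rel_words[OF append(2)] by (simp add: ev_append)
  qed auto
  define h where "h U = ev (SOME w. w \<in> U)" for U
  have h: "h (fp_class w) = ev w" if "w \<in> fp_words I K" for w
  proof -
    have "w \<in> fp_class w" using that by (simp add: fp_rel.refl)
    then have "(SOME v. v \<in> fp_class w) \<in> fp_class w" by (rule someI)
    then have "(w, SOME v. v \<in> fp_class w) \<in> fp_rel I K" by simp
    from ev_cong[OF this] show ?thesis by (simp only: h_def)
  qed
  show thesis
  proof
    show "h \<in> hom (free_product I K) E"
      by (rule homI)
        (auto simp: carrier_free_product h ev_closed mult_free_product fp_words_append ev_append)
    fix i x assume "i \<in> I" "x \<in> carrier (K i)"
    moreover from this have "\<phi> i x \<in> carrier E" using \<phi> by (auto simp: hom_def)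
    ultimately show "h (fp_inj I K i x) = \<phi> i x"
      by (simp add: fp_inj_def h fp_words_def ev_def)
  qed
qed

end

section \<open>Active sums\<close>

lemma (in group) normal_closure_normal:
  assumes "R \<subseteq> carrier G" shows "normal_closure G R \<lhd> G"
proof -
  have "\<exists>N. N \<lhd> G \<and> R \<subseteq> N"
    using assms by (intro exI[of _ "carrier G"]) (auto simp: normal_inv_iff subgroup_self)
  then have "subgroup (normal_closure G R) G"
    unfolding normal_closure_def by (intro subgroups_Inter) (auto simp: normal_inv_iff)
  then show ?thesis
    by (auto simp: normal_inv_iff normal_closure_def)
qed

lemma normal_closure_superset: "R \<subseteq> normal_closure G R"
  by (auto simp: normal_closure_def)

lemma normal_closure_least: "N \<lhd> G \<Longrightarrow> R \<subseteq> N \<Longrightarrow> normal_closure G R \<subseteq> N"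
  by (auto simp: normal_closure_def)

locale conj_family = group G for G :: "('a, 'b) monoid_scheme" (structure) +
  fixes \<F> :: "'a set set"
  assumes conj_closed: "conj_closed_family G \<F>"
begin

abbreviation FP where "FP \<equiv> family_free_product G \<F>"
abbreviation RN where "RN \<equiv> normal_closure FP (active_sum_relators G \<F>)"

definition active_inj :: "'a set \<Rightarrow> 'a \<Rightarrow> ('a set \<times> 'a) list set set" where
  "active_inj F x = RN #>\<^bsub>FP\<^esub> family_inj G \<F> F x"

lemma member_subgroup: "F \<in> \<F> \<Longrightarrow> subgroup F G"
  and conj_set_mem: "F \<in> \<F> \<Longrightarrow> g \<in> carrier G \<Longrightarrow> conj_set G F g \<in> \<F>"
  using conj_closed by (auto simp: conj_closed_family_def)

lemma member_carrier: "F \<in> \<F> \<Longrightarrow> x \<in> F \<Longrightarrow> x \<in> carrier G"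
  using member_subgroup subgroup.mem_carrier by metis

lemma member_group: "F \<in> \<F> \<Longrightarrow> group (G\<lparr>carrier := F\<rparr>)"
  using member_subgroup subgroup.subgroup_is_group is_group by metis

lemma conj_elem_mem: "g \<in> F \<Longrightarrow> conj_elem G g h \<in> conj_set G F h"
  by (simp add: conj_set_def)

sublocale factors: group_family \<F> "\<lambda>F. G\<lparr>carrier := F\<rparr>"
  by (rule group_family.intro) (rule member_group)

lemma group_FP: "group FP"
  using factors.group_free_product by (simp add: family_free_product_def)

sublocale FP: group FP
  by (rule group_FP)

lemma family_inj_hom: "F \<in> \<F> \<Longrightarrow> family_inj G \<F> F \<in> hom (G\<lparr>carrier := F\<rparr>) FP"
  using factors.fp_inj_hom by (simp add: family_free_product_def family_inj_def)

lemma family_inj_closed [simp]: "F \<in> \<F> \<Longrightarrow> x \<in> F \<Longrightarrow> family_inj G \<F> F x \<in> carrier FP"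
  using family_inj_hom by (fastforce simp: hom_def)

lemma relators_closed: "active_sum_relators G \<F> \<subseteq> carrier FP"
  by (auto simp: active_sum_relators_def member_carrier conj_set_mem conj_elem_mem)

lemma normal_RN: "RN \<lhd> FP"
  using FP.normal_closure_normal relators_closed .

sublocale RN: normal RN FP
  by (rule normal_RN)

lemma group_active_sum: "group (active_sum G \<F>)"
  using RN.factorgroup_is_group by (simp add: active_sum_def)

sublocale S: group "active_sum G \<F>"
  by (rule group_active_sum)

lemma coset_hom: "(\<lambda>a. RN #>\<^bsub>FP\<^esub> a) \<in> hom FP (active_sum G \<F>)"
  using RN.r_coset_hom_Mod by (simp add: active_sum_def)

lemma active_inj_hom:
  assumes "F \<in> \<F>" shows "active_inj F \<in> hom (G\<lparr>carrier := F\<rparr>) (active_sum G \<F>)"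
  using Group.hom_compose[OF family_inj_hom[OF assms] coset_hom]
  by (simp add: active_inj_def[abs_def] comp_def)

lemma active_inj_closed [simp]: "F \<in> \<F> \<Longrightarrow> x \<in> F \<Longrightarrow> active_inj F x \<in> carrier (active_sum G \<F>)"
  using active_inj_hom by (fastforce simp: hom_def)

text \<open>In the active sum a generator acts on the generators by conjugation as its image in \<open>G\<close>
  does. Consequently the set of generators is closed under conjugation by its own elements.\<close>

lemma active_inj_conj:
  assumes "F1 \<in> \<F>" "F2 \<in> \<F>" "h \<in> F1" "g \<in> F2"
  shows "conj_elem (active_sum G \<F>) (active_inj F2 g) (active_inj F1 h)
    = active_inj (conj_set G F2 h) (conj_elem G g h)"
proof -
  interpret co: group_hom FP "active_sum G \<F>" "\<lambda>a. RN #>\<^bsub>FP\<^esub> a"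
    by unfold_locales (rule coset_hom)
  let ?j = "family_inj G \<F>"
  let ?F = "conj_set G F2 h" and ?x = "conj_elem G g h"
  have x: "?F \<in> \<F>" "?x \<in> ?F"
    using assms by (auto intro: conj_set_mem conj_elem_mem member_carrier)
  let ?u = "inv\<^bsub>FP\<^esub> ?j F1 h \<otimes>\<^bsub>FP\<^esub> ?j F2 g \<otimes>\<^bsub>FP\<^esub> ?j F1 h"
  have u: "?u \<in> carrier FP" using assms by simp
  have "?u \<otimes>\<^bsub>FP\<^esub> inv\<^bsub>FP\<^esub> ?j ?F ?x \<in> active_sum_relators G \<F>"
    using assms unfolding active_sum_relators_def mem_Collect_eq
    by (intro exI[of _ F1] exI[of _ F2] exI[of _ h] exI[of _ g] conjI HOL.refl)
  then have "?u \<otimes>\<^bsub>FP\<^esub> inv\<^bsub>FP\<^esub> ?j ?F ?x \<in> RN"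
    by (rule subsetD[OF normal_closure_superset])
  then have "RN #>\<^bsub>FP\<^esub> (?u \<otimes>\<^bsub>FP\<^esub> inv\<^bsub>FP\<^esub> ?j ?F ?x) = \<one>\<^bsub>active_sum G \<F>\<^esub>"
    using FP.coset_join2[OF _ RN.is_subgroup] RN.subset by (auto simp: active_sum_def)
  moreover have "RN #>\<^bsub>FP\<^esub> (?u \<otimes>\<^bsub>FP\<^esub> inv\<^bsub>FP\<^esub> ?j ?F ?x)
      = conj_elem (active_sum G \<F>) (active_inj F2 g) (active_inj F1 h)
        \<otimes>\<^bsub>active_sum G \<F>\<^esub> inv\<^bsub>active_sum G \<F>\<^esub> active_inj ?F ?x"
    using assms x by (simp add: active_inj_def conj_elem_def)
  moreover have "conj_elem (active_sum G \<F>) (active_inj F2 g) (active_inj F1 h) \<in> carrier (active_sum G \<F>)"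
    "active_inj ?F ?x \<in> carrier (active_sum G \<F>)"
    using assms x by (simp_all add: conj_elem_def)
  ultimately show ?thesis
    using S.inv_equality[of "conj_elem (active_sum G \<F>) (active_inj F2 g) (active_inj F1 h)"
        "inv\<^bsub>active_sum G \<F>\<^esub> active_inj ?F ?x"] by simp
qed

definition active_gens :: "('a set \<times> 'a) list set set set" where
  "active_gens = (\<Union>F\<in>\<F>. active_inj F ` F)"

lemma active_gens_closed: "active_gens \<subseteq> carrier (active_sum G \<F>)"
  by (auto simp: active_gens_def)

lemma active_sum_generated:
  assumes "s \<in> carrier (active_sum G \<F>)"
  obtains w where "set w \<subseteq> active_gens" "s = list_prod (active_sum G \<F>) w"
proof -
  obtain W where W: "W \<in> carrier FP" "s = RN #>\<^bsub>FP\<^esub> W"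
    using assms by (auto simp: active_sum_def carrier_FactGroup)
  then obtain w where w: "w \<in> fp_words \<F> (\<lambda>F. G\<lparr>carrier := F\<rparr>)"
      "W = list_prod FP (map (\<lambda>(F, x). family_inj G \<F> F x) w)"
    using factors.fp_class_eq_list_prod factors.carrier_free_product
    by (auto simp: family_free_product_def family_inj_def)
  have "set (map (\<lambda>(F, x). family_inj G \<F> F x) w) \<subseteq> carrier FP"
    using w(1) by (auto simp: fp_words_def)
  from hom_list_prod[OF group_FP group_active_sum coset_hom this] W w
  have "s = list_prod (active_sum G \<F>) (map (\<lambda>(F, x). active_inj F x) w)"
    by (simp add: comp_def case_prod_unfold active_inj_def)
  moreover have "set (map (\<lambda>(F, x). active_inj F x) w) \<subseteq> active_gens"
    using w(1) by (auto simp: active_gens_def fp_words_def)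
  ultimately show thesis using that by blast
qed

text \<open>The homomorphism out of the free product that is given by the maps \<open>\<phi> F\<close> sends the relators to the
  identity exactly because these maps are compatible with conjugation.\<close>

lemma active_sum_universal:
  assumes E: "group E" and \<phi>: "\<And>F. F \<in> \<F> \<Longrightarrow> \<phi> F \<in> hom (G\<lparr>carrier := F\<rparr>) E"
    and conj: "\<And>F1 F2 h g. F1 \<in> \<F> \<Longrightarrow> F2 \<in> \<F> \<Longrightarrow> h \<in> F1 \<Longrightarrow> g \<in> F2 \<Longrightarrow>
      conj_elem E (\<phi> F2 g) (\<phi> F1 h) = \<phi> (conj_set G F2 h) (conj_elem G g h)"
  obtains f where "f \<in> hom (active_sum G \<F>) E"
    and "\<And>F x. F \<in> \<F> \<Longrightarrow> x \<in> F \<Longrightarrow> f (active_inj F x) = \<phi> F x"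
proof -
  interpret E: group E by (rule E)
  obtain h where h: "h \<in> hom FP E"
      "\<And>F x. F \<in> \<F> \<Longrightarrow> x \<in> F \<Longrightarrow> h (family_inj G \<F> F x) = \<phi> F x"
    using factors.free_product_universal[OF E \<phi>]
    by (auto simp: family_free_product_def family_inj_def)
  interpret h: group_hom FP E h by unfold_locales (rule h)
  have \<phi>_closed: "\<phi> F x \<in> carrier E" if "F \<in> \<F>" "x \<in> F" for F x
    using \<phi>[OF that(1)] that(2) by (auto simp: hom_def)
  have "active_sum_relators G \<F> \<subseteq> kernel FP E h"
  proof
    fix r assume r: "r \<in> active_sum_relators G \<F>"
    then obtain F1 F2 k g where F: "F1 \<in> \<F>" "F2 \<in> \<F>" "k \<in> F1" "g \<in> F2"
      and r_eq: "r = inv\<^bsub>FP\<^esub> (family_inj G \<F> F1 k) \<otimes>\<^bsub>FP\<^esub> family_inj G \<F> F2 g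
        \<otimes>\<^bsub>FP\<^esub> family_inj G \<F> F1 k
        \<otimes>\<^bsub>FP\<^esub> inv\<^bsub>FP\<^esub> (family_inj G \<F> (conj_set G F2 k) (conj_elem G g k))"
      unfolding active_sum_relators_def by blast
    have F': "conj_set G F2 k \<in> \<F>" "conj_elem G g k \<in> conj_set G F2 k"
      using F by (auto intro: conj_set_mem conj_elem_mem member_carrier)
    then have "h r = conj_elem E (\<phi> F2 g) (\<phi> F1 k)
        \<otimes>\<^bsub>E\<^esub> inv\<^bsub>E\<^esub> \<phi> (conj_set G F2 k) (conj_elem G g k)"
      using F by (simp add: r_eq h conj_elem_def)
    also have "\<dots> = \<one>\<^bsub>E\<^esub>"
      using F F' by (simp add: conj \<phi>_closed)
    finally show "r \<in> kernel FP E h"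
      using r relators_closed by (auto simp: kernel_def)
  qed
  then have "RN \<subseteq> kernel FP E h"
    by (intro normal_closure_least h.normal_kernel)
  then obtain f where "f \<in> hom (FP Mod RN) E" "\<And>x. x \<in> carrier FP \<Longrightarrow> f (RN #>\<^bsub>FP\<^esub> x) = h x"
    using h.FactGroup_universal_kernel[OF normal_RN] by metis
  then show thesis
    using that h(2) by (simp add: active_sum_def active_inj_def)
qed

end

section \<open>Finiteness of the active sum\<close>

context group
begin

lemma list_prod_conj_swap:
  assumes "set u \<subseteq> carrier G" "x \<in> carrier G"
  shows "list_prod G u \<otimes> x = x \<otimes> list_prod G (map (\<lambda>y. conj_elem G y x) u)"
  using assms(1)
proof (induction u)
  case (Cons y u)
  have "set (map (\<lambda>y. conj_elem G y x) u) \<subseteq> carrier G"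
    using Cons assms by auto
  moreover have "x \<otimes> (inv x \<otimes> z) = z" if "z \<in> carrier G" for z
    using that assms by (simp add: m_assoc[symmetric])
  ultimately show ?case
    using Cons assms by (simp add: m_assoc conj_elem_def)
qed (use assms in simp)

text \<open>Moving a letter \<open>x\<close> to the front replaces the letters it passes by their conjugates, which stay
  in \<open>X\<close>. The first occurrence of \<open>x\<close> passes only letters before it, so the remaining occurrences
  survive and the step can be repeated.\<close>

lemma list_prod_collect:
  assumes X: "X \<subseteq> carrier G" "\<And>y z. y \<in> X \<Longrightarrow> z \<in> X \<Longrightarrow> conj_elem G y z \<in> X" and x: "x \<in> X"
    and w: "set w \<subseteq> X" "k \<le> count_list w x"
  shows "\<exists>w'. set w' \<subseteq> X \<and> length w' + k = length w \<and> list_prod G w = x [^] k \<otimes> list_prod G w'"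
  using w
proof (induction k arbitrary: w)
  case 0
  have "set w \<subseteq> carrier G" using 0 X by auto
  then show ?case using 0 by (intro exI[of _ w]) auto
next
  case (Suc k)
  then have "x \<in> set w" using count_notin by fastforce
  then obtain u v where w_eq: "w = u @ x # v" and "x \<notin> set u"
    by (meson split_list_first)
  let ?u = "map (\<lambda>y. conj_elem G y x) u"
  have u: "set u \<subseteq> X" "set v \<subseteq> X" using Suc w_eq by auto
  have u': "set ?u \<subseteq> X" using u X x by auto
  have "k \<le> count_list (?u @ v) x"
    using Suc w_eq \<open>x \<notin> set u\<close> by (simp add: count_notin)
  from Suc.IH[OF _ this] u u' obtain w' where w': "set w' \<subseteq> X" "length w' + k = length (?u @ v)"
      "list_prod G (?u @ v) = x [^] k \<otimes> list_prod G w'"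
    by auto
  have carr: "x \<in> carrier G" "set u \<subseteq> carrier G" "set v \<subseteq> carrier G" "set ?u \<subseteq> carrier G"
    "set w' \<subseteq> carrier G"
    using u u' w' x X by auto
  have "list_prod G w = (list_prod G u \<otimes> x) \<otimes> list_prod G v"
    using carr by (simp add: w_eq list_prod_append m_assoc)
  also have "\<dots> = x \<otimes> list_prod G (?u @ v)"
    using carr by (simp only: list_prod_conj_swap list_prod_append m_assoc list_prod_closed)
  also have "\<dots> = (x \<otimes> x [^] k) \<otimes> list_prod G w'"
    using carr by (simp add: w' m_assoc)
  also have "x \<otimes> x [^] k = x [^] Suc k"
    using carr nat_pow_Suc2 by metis
  finally show ?case
    using w' w_eq by (intro exI[of _ w']) auto
qed

text \<open>Dietzmann's lemma. In a word longer than \<open>card X * n\<close> some letter \<open>x\<close> occurs at least \<open>n\<close> times;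
  collecting \<open>n\<close> occurrences at the front makes them cancel, since \<open>x\<close> has \<open>n\<close>-th power one. So the
  words of length at most \<open>card X * n\<close> represent all elements.\<close>

lemma finite_if_finite_torsion_generators:
  assumes X: "X \<subseteq> carrier G" "finite X" "\<And>y z. y \<in> X \<Longrightarrow> z \<in> X \<Longrightarrow> conj_elem G y z \<in> X"
    and n: "0 < n" "\<And>x. x \<in> X \<Longrightarrow> x [^] (n::nat) = \<one>"
    and gen: "\<And>g. g \<in> carrier G \<Longrightarrow> \<exists>w. set w \<subseteq> X \<and> g = list_prod G w"
  shows "finite (carrier G)"
proof -
  have short: "\<exists>w'. set w' \<subseteq> X \<and> length w' \<le> card X * n \<and> list_prod G w' = list_prod G w"
    if "set w \<subseteq> X" for w
    using that
  proof (induction "length w" arbitrary: w rule: less_induct)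
    case less
    show ?case
    proof (cases "length w \<le> card X * n")
      case False
      have "\<exists>x\<in>X. n \<le> count_list w x"
      proof (rule ccontr)
        assume "\<not> ?thesis"
        then have "(\<Sum>x\<in>X. count_list w x) \<le> (\<Sum>x\<in>X. n)"
          by (intro sum_mono) force
        then show False
          using False sum_count_set[OF less(2) X(2)] by simp
      qed
      then obtain x where x: "x \<in> X" "n \<le> count_list w x" by blast
      obtain w' where w': "set w' \<subseteq> X" "length w' + n = length w"
          "list_prod G w = x [^] n \<otimes> list_prod G w'"
        using list_prod_collect[OF X(1,3) x(1) less(2) x(2)] by blast
      have "list_prod G w = list_prod G w'"
        using w' n x X by auto
      moreover have "length w' < length w" using w' n by simp
      ultimately show ?thesis using less(1)[of w'] w' by metis
    qed (use less in blast)
  qed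
  have "carrier G \<subseteq> list_prod G ` {w. set w \<subseteq> X \<and> length w \<le> card X * n}"
  proof
    fix g assume "g \<in> carrier G"
    then obtain w where "set w \<subseteq> X" "g = list_prod G w" using gen by blast
    then obtain w' where "set w' \<subseteq> X" "length w' \<le> card X * n" "g = list_prod G w'"
      using short[of w] by auto
    then show "g \<in> list_prod G ` {w. set w \<subseteq> X \<and> length w \<le> card X * n}"
      by blast
  qed
  then show ?thesis
    using finite_lists_length_le[OF X(2)] finite_surj by blast
qed

end

text \<open>The generators form a finite set, closed under conjugation, of elements with \<open>n\<close>-th power one.\<close>

lemma (in conj_family) finite_active_sum:
  assumes fin: "finite (carrier G)" and n: "0 < n" "\<And>F x. F \<in> \<F> \<Longrightarrow> x \<in> F \<Longrightarrow> x [^] (n::nat) = \<one>"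
  shows "finite (carrier (active_sum G \<F>))"
proof (rule S.finite_if_finite_torsion_generators[OF active_gens_closed _ _ n(1)])
  have "\<F> \<subseteq> Pow (carrier G)" using member_carrier by blast
  then have "finite \<F>" "\<And>F. F \<in> \<F> \<Longrightarrow> finite F"
    using fin by (auto intro: finite_subset)
  then show "finite active_gens" by (simp add: active_gens_def)
  show "conj_elem (active_sum G \<F>) y z \<in> active_gens" if "y \<in> active_gens" "z \<in> active_gens" for y z
  proof -
    obtain F1 F2 h g where F: "F1 \<in> \<F>" "F2 \<in> \<F>" "h \<in> F1" "g \<in> F2" "y = active_inj F2 g" "z = active_inj F1 h"
      using \<open>y \<in> active_gens\<close> \<open>z \<in> active_gens\<close> by (auto simp: active_gens_def)
    then show ?thesis
      using conj_set_mem[OF F(2) member_carrier[OF F(1,3)]] conj_elem_mem[OF F(4)]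
      by (auto simp: active_inj_conj active_gens_def)
  qed
  show "x [^]\<^bsub>active_sum G \<F>\<^esub> n = \<one>\<^bsub>active_sum G \<F>\<^esub>" if x: "x \<in> active_gens" for x
  proof -
    obtain F g where F: "F \<in> \<F>" "g \<in> F" "x = active_inj F g"
      using x by (auto simp: active_gens_def)
    have pow: "g [^]\<^bsub>G\<lparr>carrier := F\<rparr>\<^esub> n = \<one>\<^bsub>G\<lparr>carrier := F\<rparr>\<^esub>"
      using F n by (simp add: nat_pow_consistent[symmetric])
    interpret group_hom "G\<lparr>carrier := F\<rparr>" "active_sum G \<F>" "active_inj F"
      using member_group[OF F(1)] active_inj_hom[OF F(1)]
      by (simp add: group_hom_def group_hom_axioms_def group_active_sum)
    show ?thesis
      using hom_nat_pow[of g n] F hom_one by (simp add: pow)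
  qed
  show "\<exists>w. set w \<subseteq> active_gens \<and> g = list_prod (active_sum G \<F>) w"
    if "g \<in> carrier (active_sum G \<F>)" for g
    using active_sum_generated[OF that] by blast
qed

section \<open>Two-cocycles and central extensions\<close>

definition two_cocycle ::
    "('a, 'b) monoid_scheme \<Rightarrow> ('c, 'd) monoid_scheme \<Rightarrow> ('a \<Rightarrow> 'a \<Rightarrow> 'c) \<Rightarrow> bool" where
  "two_cocycle S A c \<longleftrightarrow>
     (\<forall>x\<in>carrier S. \<forall>y\<in>carrier S. c x y \<in> carrier A) \<and>
     (\<forall>x\<in>carrier S. \<forall>y\<in>carrier S. \<forall>z\<in>carrier S.
        c x y \<otimes>\<^bsub>A\<^esub> c (x \<otimes>\<^bsub>S\<^esub> y) z = c y z \<otimes>\<^bsub>A\<^esub> c x (y \<otimes>\<^bsub>S\<^esub> z))"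

text \<open>Trivial coefficients, with the sign chosen so that \<open>\<lambda>x. (x, s x)\<close> is a homomorphism into the
  extension with multiplication \<open>(x, a) (y, b) = (x y, a b c(x, y))\<close>.\<close>

definition two_coboundary ::
    "('a, 'b) monoid_scheme \<Rightarrow> ('c, 'd) monoid_scheme \<Rightarrow> ('a \<Rightarrow> 'a \<Rightarrow> 'c) \<Rightarrow> bool" where
  "two_coboundary S A c \<longleftrightarrow>
     (\<exists>s\<in>carrier S \<rightarrow> carrier A. \<forall>x\<in>carrier S. \<forall>y\<in>carrier S.
        s x \<otimes>\<^bsub>A\<^esub> s y \<otimes>\<^bsub>A\<^esub> c x y = s (x \<otimes>\<^bsub>S\<^esub> y))"

lemma two_cocycle_closed:
  "two_cocycle S A c \<Longrightarrow> x \<in> carrier S \<Longrightarrow> y \<in> carrier S \<Longrightarrow> c x y \<in> carrier A"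
  by (simp add: two_cocycle_def)

lemma two_cocycle_eq:
  "two_cocycle S A c \<Longrightarrow> x \<in> carrier S \<Longrightarrow> y \<in> carrier S \<Longrightarrow> z \<in> carrier S \<Longrightarrow>
    c x y \<otimes>\<^bsub>A\<^esub> c (x \<otimes>\<^bsub>S\<^esub> y) z = c y z \<otimes>\<^bsub>A\<^esub> c x (y \<otimes>\<^bsub>S\<^esub> z)"
  by (simp add: two_cocycle_def)

lemma two_cocycle_pullback:
  assumes "two_cocycle S A c" "h \<in> hom K S" "group K"
  shows "two_cocycle K A (\<lambda>x y. c (h x) (h y))"
  using assms by (auto simp: two_cocycle_def hom_def Pi_def)

text \<open>The order of a finite group kills its second cohomology. Multiplying the cocycle identity over
  all third arguments \<open>z\<close> gives \<open>c(x, y)^|K| t(x y) = t(x) t(y)\<close> for \<open>t x = \<Prod>z. c(x, z)\<close>, because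
  \<open>z \<mapsto> y z\<close> permutes the group.\<close>

lemma two_coboundary_power_order:
  assumes K: "group K" "finite (carrier K)" and A: "comm_group A" and c: "two_cocycle K A c"
  shows "two_coboundary K A (\<lambda>x y. c x y [^]\<^bsub>A\<^esub> order K)"
proof -
  interpret K: group K by (rule K)
  interpret A: comm_group A by (rule A)
  note c_closed [simp] = two_cocycle_closed[OF c]
  define t where "t x = finprod A (c x) (carrier K)" for x
  have t_closed [simp]: "t x \<in> carrier A" if "x \<in> carrier K" for x
    using that by (simp add: t_def)
  have t_mult: "c x y [^]\<^bsub>A\<^esub> order K \<otimes>\<^bsub>A\<^esub> t (x \<otimes>\<^bsub>K\<^esub> y) = t x \<otimes>\<^bsub>A\<^esub> t y"
    if x: "x \<in> carrier K" and y: "y \<in> carrier K" for x y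
  proof -
    have inj: "inj_on (\<lambda>z. y \<otimes>\<^bsub>K\<^esub> z) (carrier K)" and im: "(\<lambda>z. y \<otimes>\<^bsub>K\<^esub> z) ` carrier K = carrier K"
      using y by (auto intro: inj_onI) (metis K.surj_const_mult image_eqI)
    have "c x y [^]\<^bsub>A\<^esub> order K \<otimes>\<^bsub>A\<^esub> t (x \<otimes>\<^bsub>K\<^esub> y)
        = finprod A (\<lambda>z. c x y \<otimes>\<^bsub>A\<^esub> c (x \<otimes>\<^bsub>K\<^esub> y) z) (carrier K)"
      using x y by (simp add: t_def A.finprod_multf A.finprod_const order_def)
    also have "\<dots> = finprod A (\<lambda>z. c y z \<otimes>\<^bsub>A\<^esub> c x (y \<otimes>\<^bsub>K\<^esub> z)) (carrier K)"
      using x y by (intro A.finprod_cong') (auto simp: two_cocycle_eq[OF c])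
    also have "\<dots> = t y \<otimes>\<^bsub>A\<^esub> finprod A (\<lambda>z. c x (y \<otimes>\<^bsub>K\<^esub> z)) (carrier K)"
      using x y by (simp add: t_def A.finprod_multf)
    also have "finprod A (\<lambda>z. c x (y \<otimes>\<^bsub>K\<^esub> z)) (carrier K) = t x"
      using A.finprod_reindex[of "c x" "\<lambda>z. y \<otimes>\<^bsub>K\<^esub> z" "carrier K"] inj im x by (simp add: t_def)
    finally show ?thesis using x y by (simp add: A.m_comm)
  qed
  show ?thesis
    unfolding two_coboundary_def
  proof (intro bexI[of _ "\<lambda>x. inv\<^bsub>A\<^esub> t x"] ballI)
    fix x y assume xy: "x \<in> carrier K" "y \<in> carrier K"
    let ?C = "c x y [^]\<^bsub>A\<^esub> order K"
    have "inv\<^bsub>A\<^esub> t x \<otimes>\<^bsub>A\<^esub> inv\<^bsub>A\<^esub> t y \<otimes>\<^bsub>A\<^esub> ?C = inv\<^bsub>A\<^esub> (?C \<otimes>\<^bsub>A\<^esub> t (x \<otimes>\<^bsub>K\<^esub> y)) \<otimes>\<^bsub>A\<^esub> ?C"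
      using xy by (simp add: t_mult A.inv_mult)
    also have "\<dots> = inv\<^bsub>A\<^esub> t (x \<otimes>\<^bsub>K\<^esub> y) \<otimes>\<^bsub>A\<^esub> (inv\<^bsub>A\<^esub> ?C \<otimes>\<^bsub>A\<^esub> ?C)"
      using xy by (simp add: A.inv_mult_group A.m_assoc)
    also have "\<dots> = inv\<^bsub>A\<^esub> t (x \<otimes>\<^bsub>K\<^esub> y)"
      using xy by simp
    finally show "inv\<^bsub>A\<^esub> t x \<otimes>\<^bsub>A\<^esub> inv\<^bsub>A\<^esub> t y \<otimes>\<^bsub>A\<^esub> ?C = inv\<^bsub>A\<^esub> t (x \<otimes>\<^bsub>K\<^esub> y)" .
  qed auto
qed

text \<open>If the coefficients have exponent \<open>p\<close> prime to the order, then raising to the power of the order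
  is invertible on them, and the preceding splitting can be transported back to \<open>c\<close>.\<close>

lemma two_coboundary_if_coprime:
  assumes K: "group K" "finite (carrier K)" and A: "comm_group A" and c: "two_cocycle K A c"
    and p: "\<And>a. a \<in> carrier A \<Longrightarrow> a [^]\<^bsub>A\<^esub> (p::nat) = \<one>\<^bsub>A\<^esub>" and cop: "coprime (order K) p"
  shows "two_coboundary K A c"
proof -
  interpret K: group K by (rule K)
  interpret A: comm_group A by (rule A)
  note c_closed [simp] = two_cocycle_closed[OF c]
  obtain s where s: "s \<in> carrier K \<rightarrow> carrier A"
    "\<And>x y. x \<in> carrier K \<Longrightarrow> y \<in> carrier K \<Longrightarrow>
      s x \<otimes>\<^bsub>A\<^esub> s y \<otimes>\<^bsub>A\<^esub> c x y [^]\<^bsub>A\<^esub> order K = s (x \<otimes>\<^bsub>K\<^esub> y)"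
    using two_coboundary_power_order[OF K A c] by (auto simp: two_coboundary_def)
  have s_closed [simp]: "s x \<in> carrier A" if "x \<in> carrier K" for x
    using s(1) that by auto
  have "order K \<noteq> 0" using K by (simp add: K.order_gt_0_iff_finite)
  then obtain m q where mq: "order K * m = p * q + 1"
    using bezout_nat[of "order K" p] cop by (auto simp: coprime_iff_gcd_eq_1)
  have pow: "(a [^]\<^bsub>A\<^esub> order K) [^]\<^bsub>A\<^esub> m = a" if a: "a \<in> carrier A" for a
  proof -
    have "(a [^]\<^bsub>A\<^esub> order K) [^]\<^bsub>A\<^esub> m = (a [^]\<^bsub>A\<^esub> p) [^]\<^bsub>A\<^esub> q \<otimes>\<^bsub>A\<^esub> a"
      using a by (simp add: A.nat_pow_pow mq A.nat_pow_mult[symmetric])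
    then show ?thesis using a by (simp add: p)
  qed
  show ?thesis
    unfolding two_coboundary_def
  proof (intro bexI[of _ "\<lambda>x. s x [^]\<^bsub>A\<^esub> m"] ballI)
    fix x y assume xy: "x \<in> carrier K" "y \<in> carrier K"
    have "(s x \<otimes>\<^bsub>A\<^esub> s y \<otimes>\<^bsub>A\<^esub> c x y [^]\<^bsub>A\<^esub> order K) [^]\<^bsub>A\<^esub> m
        = s x [^]\<^bsub>A\<^esub> m \<otimes>\<^bsub>A\<^esub> s y [^]\<^bsub>A\<^esub> m \<otimes>\<^bsub>A\<^esub> (c x y [^]\<^bsub>A\<^esub> order K) [^]\<^bsub>A\<^esub> m"
      using xy by (simp add: A.nat_pow_distrib)
    then show "s x [^]\<^bsub>A\<^esub> m \<otimes>\<^bsub>A\<^esub> s y [^]\<^bsub>A\<^esub> m \<otimes>\<^bsub>A\<^esub> c x y = s (x \<otimes>\<^bsub>K\<^esub> y) [^]\<^bsub>A\<^esub> m"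
      using xy s(2) by (simp add: pow)
  qed auto
qed

text \<open>The central extension of \<open>S\<close> by \<open>A\<close> that belongs to a cocycle. The cocycle need not be
  normalised, so the identity has second component \<open>c(1, 1)\<^sup>-\<^sup>1\<close>, and \<open>A\<close> embeds by
  \<open>d \<mapsto> (1, d c(1, 1)\<^sup>-\<^sup>1)\<close>.\<close>

locale central_extension = S: group S + A: comm_group A
  for S :: "('s, 'm) monoid_scheme" and A :: "('c, 'd) monoid_scheme" +
  fixes c :: "'s \<Rightarrow> 's \<Rightarrow> 'c"
  assumes cocycle: "two_cocycle S A c"
begin

definition E :: "('s \<times> 'c) monoid" where
  "E = \<lparr>carrier = carrier S \<times> carrier A,
        monoid.mult = (\<lambda>(x, a) (y, b). (x \<otimes>\<^bsub>S\<^esub> y, a \<otimes>\<^bsub>A\<^esub> b \<otimes>\<^bsub>A\<^esub> c x y)),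
        one = (\<one>\<^bsub>S\<^esub>, inv\<^bsub>A\<^esub> c \<one>\<^bsub>S\<^esub> \<one>\<^bsub>S\<^esub>)\<rparr>"

lemma E_simps [simp]:
  "carrier E = carrier S \<times> carrier A"
  "(x, a) \<otimes>\<^bsub>E\<^esub> (y, b) = (x \<otimes>\<^bsub>S\<^esub> y, a \<otimes>\<^bsub>A\<^esub> b \<otimes>\<^bsub>A\<^esub> c x y)"
  "\<one>\<^bsub>E\<^esub> = (\<one>\<^bsub>S\<^esub>, inv\<^bsub>A\<^esub> c \<one>\<^bsub>S\<^esub> \<one>\<^bsub>S\<^esub>)"
  by (simp_all add: E_def)

lemmas c_closed [simp] = two_cocycle_closed[OF cocycle]

lemma c_one_left: "x \<in> carrier S \<Longrightarrow> c \<one>\<^bsub>S\<^esub> x = c \<one>\<^bsub>S\<^esub> \<one>\<^bsub>S\<^esub>"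
  using two_cocycle_eq[OF cocycle, of "\<one>\<^bsub>S\<^esub>" "\<one>\<^bsub>S\<^esub>" x] by simp

lemma c_one_right: "x \<in> carrier S \<Longrightarrow> c x \<one>\<^bsub>S\<^esub> = c \<one>\<^bsub>S\<^esub> \<one>\<^bsub>S\<^esub>"
  using two_cocycle_eq[OF cocycle, of x "\<one>\<^bsub>S\<^esub>" "\<one>\<^bsub>S\<^esub>"] by simp

abbreviation e where "e \<equiv> c \<one>\<^bsub>S\<^esub> \<one>\<^bsub>S\<^esub>"

lemma group_E: "group E"
proof (rule groupI)
  fix u v assume "u \<in> carrier E" "v \<in> carrier E"
  then show "u \<otimes>\<^bsub>E\<^esub> v \<in> carrier E" by auto
next
  fix u v w assume "u \<in> carrier E" "v \<in> carrier E" "w \<in> carrier E"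
  then obtain x a y b z d where u: "u = (x, a)" "v = (y, b)" "w = (z, d)"
    and S: "x \<in> carrier S" "y \<in> carrier S" "z \<in> carrier S"
    and A: "a \<in> carrier A" "b \<in> carrier A" "d \<in> carrier A" by auto
  have "a \<otimes>\<^bsub>A\<^esub> b \<otimes>\<^bsub>A\<^esub> c x y \<otimes>\<^bsub>A\<^esub> d \<otimes>\<^bsub>A\<^esub> c (x \<otimes>\<^bsub>S\<^esub> y) z
      = a \<otimes>\<^bsub>A\<^esub> b \<otimes>\<^bsub>A\<^esub> d \<otimes>\<^bsub>A\<^esub> (c x y \<otimes>\<^bsub>A\<^esub> c (x \<otimes>\<^bsub>S\<^esub> y) z)"
    using S A by (simp add: A.m_ac)
  also have "\<dots> = a \<otimes>\<^bsub>A\<^esub> (b \<otimes>\<^bsub>A\<^esub> d \<otimes>\<^bsub>A\<^esub> c y z) \<otimes>\<^bsub>A\<^esub> c x (y \<otimes>\<^bsub>S\<^esub> z)"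
    using S A by (simp add: two_cocycle_eq[OF cocycle] A.m_assoc)
  finally show "u \<otimes>\<^bsub>E\<^esub> v \<otimes>\<^bsub>E\<^esub> w = u \<otimes>\<^bsub>E\<^esub> (v \<otimes>\<^bsub>E\<^esub> w)"
    using S by (simp add: u S.m_assoc)
next
  fix u assume "u \<in> carrier E"
  then obtain x a where u: "u = (x, a)" "x \<in> carrier S" "a \<in> carrier A" by auto
  have "inv\<^bsub>A\<^esub> e \<otimes>\<^bsub>A\<^esub> a \<otimes>\<^bsub>A\<^esub> e = a \<otimes>\<^bsub>A\<^esub> (inv\<^bsub>A\<^esub> e \<otimes>\<^bsub>A\<^esub> e)"
    using u by (simp only: A.m_ac A.inv_closed c_closed S.one_closed)
  then show "\<one>\<^bsub>E\<^esub> \<otimes>\<^bsub>E\<^esub> u = u"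
    using u by (simp add: c_one_left[OF u(2)])
  let ?y = "inv\<^bsub>S\<^esub> x"
  \<comment> \<open>chosen so that the second component of \<open>(?y, ?b) (x, a)\<close> is that of the identity\<close>
  let ?b = "inv\<^bsub>A\<^esub> (a \<otimes>\<^bsub>A\<^esub> c ?y x) \<otimes>\<^bsub>A\<^esub> inv\<^bsub>A\<^esub> e"
  have "?b \<otimes>\<^bsub>A\<^esub> a \<otimes>\<^bsub>A\<^esub> c ?y x = inv\<^bsub>A\<^esub> e \<otimes>\<^bsub>A\<^esub> (inv\<^bsub>A\<^esub> (a \<otimes>\<^bsub>A\<^esub> c ?y x) \<otimes>\<^bsub>A\<^esub> (a \<otimes>\<^bsub>A\<^esub> c ?y x))"
    using u by (simp only: A.m_ac A.inv_closed c_closed S.one_closed S.inv_closed A.m_closed)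
  also have "\<dots> = inv\<^bsub>A\<^esub> e"
    using u by simp
  finally show "\<exists>v\<in>carrier E. v \<otimes>\<^bsub>E\<^esub> u = \<one>\<^bsub>E\<^esub>"
    using u by (intro bexI[of _ "(?y, ?b)"]) auto
qed auto

sublocale E: group E
  by (rule group_E)

lemma fst_hom: "fst \<in> hom E S"
  by (auto simp: hom_def)

sublocale proj: group_hom E S fst
  by unfold_locales (rule fst_hom)

lemma central_hom: "(\<lambda>d. (\<one>\<^bsub>S\<^esub>, d \<otimes>\<^bsub>A\<^esub> inv\<^bsub>A\<^esub> e)) \<in> hom A E"
proof (rule homI)
  fix a b assume ab: "a \<in> carrier A" "b \<in> carrier A"
  have "(a \<otimes>\<^bsub>A\<^esub> inv\<^bsub>A\<^esub> e) \<otimes>\<^bsub>A\<^esub> (b \<otimes>\<^bsub>A\<^esub> inv\<^bsub>A\<^esub> e) \<otimes>\<^bsub>A\<^esub> e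
      = (a \<otimes>\<^bsub>A\<^esub> b \<otimes>\<^bsub>A\<^esub> inv\<^bsub>A\<^esub> e) \<otimes>\<^bsub>A\<^esub> (inv\<^bsub>A\<^esub> e \<otimes>\<^bsub>A\<^esub> e)"
    using ab by (simp only: A.m_ac A.inv_closed c_closed S.one_closed A.m_closed)
  then show "(\<one>\<^bsub>S\<^esub>, (a \<otimes>\<^bsub>A\<^esub> b) \<otimes>\<^bsub>A\<^esub> inv\<^bsub>A\<^esub> e)
      = (\<one>\<^bsub>S\<^esub>, a \<otimes>\<^bsub>A\<^esub> inv\<^bsub>A\<^esub> e) \<otimes>\<^bsub>E\<^esub> (\<one>\<^bsub>S\<^esub>, b \<otimes>\<^bsub>A\<^esub> inv\<^bsub>A\<^esub> e)"
    using ab by simp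
qed auto

text \<open>Two elements over the same point differ by a central \<open>d\<close> from \<open>A\<close>. If both have \<open>n\<close>-th power
  one, then so has \<open>d\<close>; but \<open>d\<close> also has \<open>p\<close>-th power one, and \<open>n\<close> and \<open>p\<close> are coprime.\<close>

lemma torsion_lift_unique:
  assumes u: "u \<in> carrier E" "u [^]\<^bsub>E\<^esub> (n::nat) = \<one>\<^bsub>E\<^esub>"
    and v: "v \<in> carrier E" "v [^]\<^bsub>E\<^esub> n = \<one>\<^bsub>E\<^esub>" and fst: "fst u = fst v"
    and p: "\<And>a. a \<in> carrier A \<Longrightarrow> a [^]\<^bsub>A\<^esub> (p::nat) = \<one>\<^bsub>A\<^esub>" and cop: "coprime n p"
  shows "u = v"
proof -
  obtain x a b where x: "u = (x, a)" "v = (x, b)" "x \<in> carrier S" "a \<in> carrier A" "b \<in> carrier A"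
    using u v fst by (cases u; cases v) auto
  interpret \<kappa>: group_hom A E "\<lambda>d. (\<one>\<^bsub>S\<^esub>, d \<otimes>\<^bsub>A\<^esub> inv\<^bsub>A\<^esub> e)"
    by unfold_locales (rule central_hom)
  let ?\<kappa> = "\<lambda>d. (\<one>\<^bsub>S\<^esub>, d \<otimes>\<^bsub>A\<^esub> inv\<^bsub>A\<^esub> e)"
  define d where "d = a \<otimes>\<^bsub>A\<^esub> inv\<^bsub>A\<^esub> b"
  have d: "d \<in> carrier A" using x by (simp add: d_def)
  have v_\<kappa>: "v \<otimes>\<^bsub>E\<^esub> ?\<kappa> d = (x, b \<otimes>\<^bsub>A\<^esub> d)" and \<kappa>_v: "?\<kappa> d \<otimes>\<^bsub>E\<^esub> v = (x, b \<otimes>\<^bsub>A\<^esub> d)"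
    using x d
    by (simp_all add: c_one_left[OF x(3)] c_one_right[OF x(3)] A.m_assoc, simp_all add: A.m_ac)
  have "b \<otimes>\<^bsub>A\<^esub> d = a \<otimes>\<^bsub>A\<^esub> (inv\<^bsub>A\<^esub> b \<otimes>\<^bsub>A\<^esub> b)"
    using x by (simp only: d_def A.m_ac A.inv_closed A.m_closed)
  then have bd: "b \<otimes>\<^bsub>A\<^esub> d = a" using x by simp
  have "u [^]\<^bsub>E\<^esub> n = v [^]\<^bsub>E\<^esub> n \<otimes>\<^bsub>E\<^esub> ?\<kappa> d [^]\<^bsub>E\<^esub> n"
  proof -
    have "(v \<otimes>\<^bsub>E\<^esub> ?\<kappa> d) [^]\<^bsub>E\<^esub> n = v [^]\<^bsub>E\<^esub> n \<otimes>\<^bsub>E\<^esub> ?\<kappa> d [^]\<^bsub>E\<^esub> n"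
      using v_\<kappa> \<kappa>_v v d \<kappa>.hom_closed by (intro E.pow_mult_distrib) auto
    then show ?thesis using v_\<kappa> bd x by simp
  qed
  also have "?\<kappa> d [^]\<^bsub>E\<^esub> n = ?\<kappa> (d [^]\<^bsub>A\<^esub> n)"
    using \<kappa>.hom_nat_pow[OF d] by simp
  finally have "d [^]\<^bsub>A\<^esub> n = \<one>\<^bsub>A\<^esub>"
    using u(2) v(2) d E.l_one[OF \<kappa>.hom_closed[OF A.nat_pow_closed[OF d, of n]]]
      A.right_cancel[of "inv\<^bsub>A\<^esub> e" "d [^]\<^bsub>A\<^esub> n" "\<one>\<^bsub>A\<^esub>"]
    by simp
  then have "group.ord A d dvd gcd n p"
    using p[OF d] A.pow_eq_id[OF d] by simp
  then have "group.ord A d = 1"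
    using cop by (simp only: coprime_iff_gcd_eq_1 nat_dvd_1_iff_1)
  then have "d = \<one>\<^bsub>A\<^esub>"
    using A.ord_eq_1[OF d] by simp
  then show ?thesis using bd x by simp
qed

end

text \<open>The central extension splits over each member \<open>F\<close>, since \<open>F\<close> has order prime to \<open>p\<close>. The partial
  sections are automatically compatible with conjugation: both sides of the compatibility equation
  are lifts of one element of the active sum, and both have \<open>n\<close>-th power one, so uniqueness of such
  lifts applies. By the universal property the sections glue to a section over the active sum.\<close>

lemma (in conj_family) cocycle_on_active_sum_splits:
  assumes A: "comm_group A" and c: "two_cocycle (active_sum G \<F>) A c"
    and p: "\<And>a. a \<in> carrier A \<Longrightarrow> a [^]\<^bsub>A\<^esub> (p::nat) = \<one>\<^bsub>A\<^esub>" and cop: "coprime n p"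
    and fin: "\<And>F. F \<in> \<F> \<Longrightarrow> finite F" "\<And>F. F \<in> \<F> \<Longrightarrow> coprime (card F) p"
    and n: "\<And>F x. F \<in> \<F> \<Longrightarrow> x \<in> F \<Longrightarrow> x [^] (n::nat) = \<one>"
  shows "two_coboundary (active_sum G \<F>) A c"
proof -
  let ?S = "active_sum G \<F>"
  interpret central_extension ?S A c
    using A c by (simp add: central_extension_def central_extension_axioms_def group_active_sum)
  have "\<exists>s. s \<in> F \<rightarrow> carrier A \<and> (\<forall>x\<in>F. \<forall>y\<in>F.
      s x \<otimes>\<^bsub>A\<^esub> s y \<otimes>\<^bsub>A\<^esub> c (active_inj F x) (active_inj F y) = s (x \<otimes> y))" if "F \<in> \<F>" for F
    using two_coboundary_if_coprime[OF member_group[OF that] _ A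
        two_cocycle_pullback[OF c active_inj_hom[OF that] member_group[OF that]] p]
      fin[OF that]
    by (auto simp: two_coboundary_def order_def)
  then obtain s where s: "\<And>F. F \<in> \<F> \<Longrightarrow> s F \<in> F \<rightarrow> carrier A"
    "\<And>F x y. F \<in> \<F> \<Longrightarrow> x \<in> F \<Longrightarrow> y \<in> F \<Longrightarrow>
      s F x \<otimes>\<^bsub>A\<^esub> s F y \<otimes>\<^bsub>A\<^esub> c (active_inj F x) (active_inj F y) = s F (x \<otimes> y)"
    by metis
  define \<phi> where "\<phi> F x = (active_inj F x, s F x)" for F x
  have \<phi>_hom: "\<phi> F \<in> hom (G\<lparr>carrier := F\<rparr>) E" if F: "F \<in> \<F>" for F
  proof (rule homI)
    show "\<phi> F x \<in> carrier E" if "x \<in> carrier (G\<lparr>carrier := F\<rparr>)" for x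
      using that F s(1)[OF F] by (auto simp: \<phi>_def)
    show "\<phi> F (x \<otimes>\<^bsub>G\<lparr>carrier := F\<rparr>\<^esub> y) = \<phi> F x \<otimes>\<^bsub>E\<^esub> \<phi> F y"
      if "x \<in> carrier (G\<lparr>carrier := F\<rparr>)" "y \<in> carrier (G\<lparr>carrier := F\<rparr>)" for x y
      using that F s(2)[OF F] hom_mult[OF active_inj_hom[OF F], of x y] by (simp add: \<phi>_def)
  qed
  have \<phi>_closed: "\<phi> F x \<in> carrier E" if "F \<in> \<F>" "x \<in> F" for F x
    using \<phi>_hom[OF that(1)] that(2) by (auto simp: hom_def)
  have \<phi>_pow: "\<phi> F x [^]\<^bsub>E\<^esub> n = \<one>\<^bsub>E\<^esub>" if F: "F \<in> \<F>" and x: "x \<in> F" for F x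
  proof -
    have pow: "x [^]\<^bsub>G\<lparr>carrier := F\<rparr>\<^esub> n = \<one>\<^bsub>G\<lparr>carrier := F\<rparr>\<^esub>"
      using n[OF F x] by (simp add: nat_pow_consistent[symmetric])
    interpret h: group_hom "G\<lparr>carrier := F\<rparr>" E "\<phi> F"
      using member_group[OF F] \<phi>_hom[OF F] by (simp add: group_hom_def group_hom_axioms_def group_E)
    show ?thesis
      using h.hom_nat_pow[of x n] x h.hom_one by (simp add: pow)
  qed
  \<comment> \<open>Both sides lie over the same element of the active sum, by \<open>active_inj_conj\<close>.\<close>
  have \<phi>_conj: "conj_elem E (\<phi> F2 g) (\<phi> F1 h) = \<phi> (conj_set G F2 h) (conj_elem G g h)"
    if F: "F1 \<in> \<F>" "F2 \<in> \<F>" "h \<in> F1" "g \<in> F2" for F1 F2 h g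
  proof (rule torsion_lift_unique[OF _ _ _ _ _ p cop])
    have F': "conj_set G F2 h \<in> \<F>" "conj_elem G g h \<in> conj_set G F2 h"
      using F by (auto intro: conj_set_mem conj_elem_mem member_carrier)
    show "\<phi> (conj_set G F2 h) (conj_elem G g h) \<in> carrier E"
      "\<phi> (conj_set G F2 h) (conj_elem G g h) [^]\<^bsub>E\<^esub> n = \<one>\<^bsub>E\<^esub>"
      using \<phi>_closed[OF F'] \<phi>_pow[OF F'] .
    show "conj_elem E (\<phi> F2 g) (\<phi> F1 h) \<in> carrier E"
      by (intro E.conj_elem_closed \<phi>_closed F)
    have "conj_elem E (\<phi> F2 g) (\<phi> F1 h) [^]\<^bsub>E\<^esub> n = conj_elem E \<one>\<^bsub>E\<^esub> (\<phi> F1 h)"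
      by (simp only: E.conj_elem_pow \<phi>_closed F \<phi>_pow)
    also have "\<dots> = \<one>\<^bsub>E\<^esub>"
      using \<phi>_closed[OF F(1,3)] by (simp only: conj_elem_def E.r_one E.inv_closed E.l_inv)
    finally show "conj_elem E (\<phi> F2 g) (\<phi> F1 h) [^]\<^bsub>E\<^esub> n = \<one>\<^bsub>E\<^esub>" .
    have "fst (conj_elem E (\<phi> F2 g) (\<phi> F1 h)) = conj_elem ?S (fst (\<phi> F2 g)) (fst (\<phi> F1 h))"
      unfolding conj_elem_def
      by (simp only: proj.hom_mult proj.hom_inv E.m_closed E.inv_closed \<phi>_closed F)
    then show "fst (conj_elem E (\<phi> F2 g) (\<phi> F1 h)) = fst (\<phi> (conj_set G F2 h) (conj_elem G g h))"
      using F by (simp add: \<phi>_def active_inj_conj)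
  qed
  obtain f where f: "f \<in> hom ?S E" "\<And>F x. F \<in> \<F> \<Longrightarrow> x \<in> F \<Longrightarrow> f (active_inj F x) = \<phi> F x"
    using active_sum_universal[OF group_E \<phi>_hom \<phi>_conj] by blast
  \<comment> \<open>\<open>f\<close> is a section, because the endomorphism \<open>fst \<circ> f\<close> fixes the generators.\<close>
  have fst_f: "fst (f x) = x" if x: "x \<in> carrier ?S" for x
  proof -
    obtain w where w: "set w \<subseteq> active_gens" "x = list_prod ?S w"
      using active_sum_generated[OF x] by blast
    have "fst (f x) = list_prod ?S (map (fst \<circ> f) w)"
      using hom_list_prod[OF group_active_sum group_active_sum Group.hom_compose[OF f(1) fst_hom]]
        w active_gens_closed by (auto simp: comp_def)
    also have "map (fst \<circ> f) w = w"
      using w(1) f(2) by (intro map_idI) (auto simp: active_gens_def \<phi>_def)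
    finally show ?thesis using w by simp
  qed
  have f_eq: "f x = (x, snd (f x))" "snd (f x) \<in> carrier A" if "x \<in> carrier ?S" for x
  proof -
    show "f x = (x, snd (f x))" using fst_f[OF that] by (metis prod.collapse)
    have "f x \<in> carrier E" using f(1) that by (auto simp: hom_def)
    then show "snd (f x) \<in> carrier A" by auto
  qed
  show ?thesis
    unfolding two_coboundary_def
  proof (intro bexI[of _ "\<lambda>x. snd (f x)"] ballI)
    fix x y assume xy: "x \<in> carrier ?S" "y \<in> carrier ?S"
    have "f (x \<otimes>\<^bsub>?S\<^esub> y) = (x, snd (f x)) \<otimes>\<^bsub>E\<^esub> (y, snd (f y))"
      using hom_mult[OF f(1) xy] f_eq(1)[OF xy(1)] f_eq(1)[OF xy(2)] by simp
    then show "snd (f x) \<otimes>\<^bsub>A\<^esub> snd (f y) \<otimes>\<^bsub>A\<^esub> c x y = snd (f (x \<otimes>\<^bsub>?S\<^esub> y))" by simp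
  qed (use f_eq(2) in auto)
qed

section \<open>The bar complex in low degrees\<close>

lemma frag_cmul_diff: "frag_cmul k (u - v) = frag_cmul k u - frag_cmul k v"
  by (rule poly_mapping_eqI) (simp add: lookup_minus algebra_simps)

text \<open>For the difference of two cycles that agree modulo \<open>m\<close>: the quotient by \<open>m\<close> is again a chain, by
  the condition on the support, and a cycle because the 1-chains have no torsion.\<close>

lemma frag_divisible:
  assumes "0 < m" "\<And>x. int m dvd Poly_Mapping.lookup u x"
  obtains w where "u = frag_cmul (int m) w" "Poly_Mapping.keys w \<subseteq> Poly_Mapping.keys u"
proof
  let ?w = "Poly_Mapping.map (\<lambda>k. k div int m) u"
  show "u = frag_cmul (int m) ?w"
    using assms by (intro poly_mapping_eqI) (auto simp: Poly_Mapping.map.rep_eq when_def)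
  show "Poly_Mapping.keys ?w \<subseteq> Poly_Mapping.keys u"
    by (auto simp: in_keys_iff Poly_Mapping.map.rep_eq when_def)
qed

lemma bar_boundary_0 [simp]: "bar_boundary G 0 = 0"
  and bar_boundary_add: "bar_boundary G (u + v) = bar_boundary G u + bar_boundary G v"
  and bar_boundary_diff: "bar_boundary G (u - v) = bar_boundary G u - bar_boundary G v"
  and bar_boundary_cmul: "bar_boundary G (frag_cmul k u) = frag_cmul k (bar_boundary G u)"
  by (simp_all add: bar_boundary_def frag_extend_add frag_extend_diff frag_extend_cmul)

lemma bar_boundary_2:
  "bar_boundary G (frag_of [x, y]) = frag_of [y] - frag_of [x \<otimes>\<^bsub>G\<^esub> y] + frag_of [x]"
  by (simp add: bar_boundary_def bar_face_def numeral_2_eq_2)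

lemma bar_boundary_3:
  "bar_boundary G (frag_of [x, y, z])
    = frag_of [y, z] - frag_of [x \<otimes>\<^bsub>G\<^esub> y, z] + frag_of [x, y \<otimes>\<^bsub>G\<^esub> z] - frag_of [x, y]"
  by (simp add: bar_boundary_def bar_face_def numeral_3_eq_3)

lemma carrier_bar_chains:
  "c \<in> carrier (bar_chains G n) \<longleftrightarrow> Poly_Mapping.keys c \<subseteq> {xs. length xs = n \<and> set xs \<subseteq> carrier G}"
  by (simp add: bar_chains_def)

lemma comm_group_bar_chains: "comm_group (bar_chains G n)"
  by (simp add: bar_chains_def abelian_free_Abelian_group)

lemma bar_chains_simps [simp]:
  "\<one>\<^bsub>bar_chains G n\<^esub> = 0" "u \<otimes>\<^bsub>bar_chains G n\<^esub> v = u + v"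
  "u [^]\<^bsub>bar_chains G n\<^esub> (k::nat) = frag_cmul (int k) u"
  "u \<in> carrier (bar_chains G n) \<Longrightarrow> inv\<^bsub>bar_chains G n\<^esub> u = - u"
  by (simp_all add: bar_chains_def)

lemma zero_bar_chains: "0 \<in> carrier (bar_chains G n)"
  by (simp add: carrier_bar_chains)

lemma add_bar_chains:
  "u \<in> carrier (bar_chains G n) \<Longrightarrow> v \<in> carrier (bar_chains G n) \<Longrightarrow> u + v \<in> carrier (bar_chains G n)"
  unfolding carrier_bar_chains using keys_add[of u v] by blast

lemma diff_bar_chains:
  "u \<in> carrier (bar_chains G n) \<Longrightarrow> v \<in> carrier (bar_chains G n) \<Longrightarrow> u - v \<in> carrier (bar_chains G n)"
  unfolding carrier_bar_chains using keys_diff[of u v] by blast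

lemma cmul_bar_chains: "u \<in> carrier (bar_chains G n) \<Longrightarrow> frag_cmul k u \<in> carrier (bar_chains G n)"
  unfolding carrier_bar_chains using keys_cmul[of k u] by blast

lemma frag_of_bar_chains:
  "frag_of xs \<in> carrier (bar_chains G n) \<longleftrightarrow> length xs = n \<and> set xs \<subseteq> carrier G"
  by (simp add: carrier_bar_chains)

lemmas bar_chains_closed =
  zero_bar_chains add_bar_chains diff_bar_chains cmul_bar_chains frag_of_bar_chains

lemma bar_chains_induct [consumes 1, case_names zero diff gen]:
  assumes "u \<in> carrier (bar_chains G n)" "P 0"
    "\<And>u v. u \<in> carrier (bar_chains G n) \<Longrightarrow> v \<in> carrier (bar_chains G n) \<Longrightarrow> P u \<Longrightarrow> P v \<Longrightarrow> P (u - v)"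
    "\<And>xs. length xs = n \<Longrightarrow> set xs \<subseteq> carrier G \<Longrightarrow> P (frag_of xs)"
  shows "P u"
  using assms unfolding carrier_bar_chains
  by (intro free_Abelian_group_induct[of u "{xs. length xs = n \<and> set xs \<subseteq> carrier G}" P]) auto

lemma bar_cycles_2_iff:
  "z \<in> bar_cycles G 2 \<longleftrightarrow> z \<in> carrier (bar_chains G 2) \<and> bar_boundary G z = 0"
  by (simp add: bar_cycles_def kernel_def)

lemma bar_coset_eq_iff:
  assumes D: "subgroup D (bar_chains G n)"
    and uv: "u \<in> carrier (bar_chains G n)" "v \<in> carrier (bar_chains G n)"
  shows "D #>\<^bsub>bar_chains G n\<^esub> u = D #>\<^bsub>bar_chains G n\<^esub> v \<longleftrightarrow> u - v \<in> D"
proof -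
  interpret C: comm_group "bar_chains G n" by (rule comm_group_bar_chains)
  have "u \<in> D #>\<^bsub>bar_chains G n\<^esub> v \<longleftrightarrow> u - v \<in> D"
    using subgroup.rcos_module[OF D C.is_group uv(2,1)] uv by simp
  then show ?thesis
    using C.repr_independence[OF _ uv(2) D, of u] C.rcos_self[OF uv(1) D] by metis
qed

context group
begin

lemma bar_boundary_closed_2:
  assumes "u \<in> carrier (bar_chains G 3)" shows "bar_boundary G u \<in> carrier (bar_chains G 2)"
  using assms
proof (induction rule: bar_chains_induct)
  case (gen xs)
  then obtain x y z where "xs = [x, y, z]"
    by (auto simp: numeral_3_eq_3 length_Suc_conv)
  then show ?case
    using gen by (auto simp: bar_boundary_3 intro!: bar_chains_closed(2,3)) (auto simp: bar_chains_closed)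
qed (auto simp: bar_boundary_diff intro: bar_chains_closed)

lemma bar_boundary_boundary_3:
  assumes "u \<in> carrier (bar_chains G 3)" shows "bar_boundary G (bar_boundary G u) = 0"
  using assms
proof (induction rule: bar_chains_induct)
  case (gen xs)
  then obtain x y z where "xs = [x, y, z]"
    by (auto simp: numeral_3_eq_3 length_Suc_conv)
  then show ?case
    using gen by (simp add: bar_boundary_3 bar_boundary_2 bar_boundary_add bar_boundary_diff m_assoc)
qed (auto simp: bar_boundary_diff)

lemma bar_boundaries_2_subset: "bar_boundaries G 2 \<subseteq> bar_cycles G 2"
  by (auto simp: bar_boundaries_def bar_cycles_2_iff bar_boundary_closed_2 bar_boundary_boundary_3)

lemma subgroup_bar_boundaries_2: "subgroup (bar_boundaries G 2) (bar_chains G 2)"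
proof -
  interpret group_hom "bar_chains G 3" "bar_chains G 2" "bar_boundary G"
    using comm_group_bar_chains[of G] bar_boundary_closed_2
    by (auto simp: group_hom_def group_hom_axioms_def comm_group_def hom_def bar_boundary_add)
  show ?thesis using img_is_subgroup by (simp add: bar_boundaries_def)
qed

lemma subgroup_bar_cycles_2: "subgroup (bar_cycles G 2) (bar_chains G 2)"
proof (rule group.subgroupI[OF comm_group.axioms(2)[OF comm_group_bar_chains]])
  have "0 \<in> bar_cycles G 2" by (simp add: bar_cycles_2_iff bar_chains_closed)
  then show "bar_cycles G 2 \<noteq> {}" by blast
qed (auto simp: bar_cycles_2_iff bar_boundary_add bar_chains_closed bar_boundary_cmul[of G "-1", simplified]
    dest: bar_chains_closed(4)[of _ _ _ "-1"])

text \<open>The boundary of \<open>[x|y|z]\<close> is the cocycle identity for \<open>(x, y) \<mapsto> [x|y]\<close>. So \<open>[x|y]\<close> becomes a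
  cocycle as soon as the boundaries are divided out.\<close>

lemma universal_two_cocycle:
  assumes D: "subgroup D (bar_chains G 2)" and sub: "bar_boundaries G 2 \<subseteq> D"
  shows "two_cocycle G (bar_chains G 2 Mod D) (\<lambda>x y. D #>\<^bsub>bar_chains G 2\<^esub> frag_of [x, y])"
proof -
  interpret C: comm_group "bar_chains G 2" by (rule comm_group_bar_chains)
  interpret D: normal D "bar_chains G 2" using D by (simp add: C.normal_iff_subgroup)
  have gen: "frag_of [x, y] \<in> carrier (bar_chains G 2)" if "x \<in> carrier G" "y \<in> carrier G" for x y
    using that by (simp add: bar_chains_closed)
  show ?thesis
    unfolding two_cocycle_def
  proof (intro conjI ballI)
    fix x y z assume xyz: "x \<in> carrier G" "y \<in> carrier G" "z \<in> carrier G"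
    have "bar_boundary G (frag_of [x, y, z]) \<in> D"
      using xyz sub by (auto simp: bar_boundaries_def bar_chains_closed)
    then have "(frag_of [y, z] + frag_of [x, y \<otimes> z]) - (frag_of [x, y] + frag_of [x \<otimes> y, z]) \<in> D"
      by (simp add: bar_boundary_3 algebra_simps)
    then have "D #>\<^bsub>bar_chains G 2\<^esub> (frag_of [x, y] + frag_of [x \<otimes> y, z])
        = D #>\<^bsub>bar_chains G 2\<^esub> (frag_of [y, z] + frag_of [x, y \<otimes> z])"
      using bar_coset_eq_iff[OF D] xyz gen bar_chains_closed(2) by (metis m_closed)
    then show "(D #>\<^bsub>bar_chains G 2\<^esub> frag_of [x, y]) \<otimes>\<^bsub>bar_chains G 2 Mod D\<^esub>
        (D #>\<^bsub>bar_chains G 2\<^esub> frag_of [x \<otimes> y, z])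
      = (D #>\<^bsub>bar_chains G 2\<^esub> frag_of [y, z]) \<otimes>\<^bsub>bar_chains G 2 Mod D\<^esub>
        (D #>\<^bsub>bar_chains G 2\<^esub> frag_of [x, y \<otimes> z])"
      using xyz by (simp add: D.rcos_sum gen)
  qed (use gen in \<open>auto simp: carrier_FactGroup\<close>)
qed

text \<open>If \<open>k[x|y] + s(x) + s(y) - s(x y)\<close> lies in \<open>D\<close>, then by linearity so does \<open>k w + s(\<partial>w)\<close> for every
  2-chain \<open>w\<close>, because \<open>\<partial>[x|y] = [x] + [y] - [x y]\<close>. For a cycle the second term vanishes. This
  passes from cohomology to homology without the universal coefficient theorem.\<close>

lemma cycle_multiple_mem_if_coboundary:
  assumes D: "subgroup D (bar_chains G 2)"
    and cob: "two_coboundary G (bar_chains G 2 Mod D)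
      (\<lambda>x y. (D #>\<^bsub>bar_chains G 2\<^esub> frag_of [x, y]) [^]\<^bsub>bar_chains G 2 Mod D\<^esub> (k::nat))"
    and z: "z \<in> bar_cycles G 2"
  shows "frag_cmul (int k) z \<in> D"
proof -
  interpret C: comm_group "bar_chains G 2" by (rule comm_group_bar_chains)
  interpret D: normal D "bar_chains G 2" using D by (simp add: C.normal_iff_subgroup)
  have gen: "frag_of [x, y] \<in> carrier (bar_chains G 2)" if "x \<in> carrier G" "y \<in> carrier G" for x y
    using that by (simp add: bar_chains_closed)
  obtain s where s: "s \<in> carrier G \<rightarrow> carrier (bar_chains G 2 Mod D)"
    "\<And>x y. x \<in> carrier G \<Longrightarrow> y \<in> carrier G \<Longrightarrow> s x \<otimes>\<^bsub>bar_chains G 2 Mod D\<^esub> s y \<otimes>\<^bsub>bar_chains G 2 Mod D\<^esub>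
      (D #>\<^bsub>bar_chains G 2\<^esub> frag_of [x, y]) [^]\<^bsub>bar_chains G 2 Mod D\<^esub> k = s (x \<otimes> y)"
    using cob by (auto simp: two_coboundary_def)
  have "\<forall>x\<in>carrier G. \<exists>u. u \<in> carrier (bar_chains G 2) \<and> s x = D #>\<^bsub>bar_chains G 2\<^esub> u"
    using s(1) by (auto simp: carrier_FactGroup Pi_iff)
  then obtain t where t: "\<And>x. x \<in> carrier G \<Longrightarrow> t x \<in> carrier (bar_chains G 2)"
    "\<And>x. x \<in> carrier G \<Longrightarrow> s x = D #>\<^bsub>bar_chains G 2\<^esub> t x"
    by metis
  \<comment> \<open>the linear extension of \<open>[x] \<mapsto> t x\<close> to 1-chains, where \<open>t\<close> lifts \<open>s\<close> to 2-chains\<close>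
  define T where "T = frag_extend (\<lambda>xs. t (hd xs))"
  have D_diff: "u - v \<in> D" if "u \<in> D" "v \<in> D" for u v
    using subgroup.m_closed[OF D that(1) subgroup.m_inv_closed[OF D that(2)]]
      that D.subset by auto
  have "frag_cmul (int k) w + T (bar_boundary G w) \<in> D" if "w \<in> carrier (bar_chains G 2)" for w
    using that
  proof (induction rule: bar_chains_induct)
    case zero
    then show ?case using D.one_closed by (simp add: T_def)
  next
    case (diff u v)
    then show ?case
      using D_diff[OF diff(3,4)]
      by (simp add: T_def bar_boundary_diff frag_extend_diff frag_cmul_diff algebra_simps)
  next
    case (gen xs)
    then obtain x y where xs: "xs = [x, y]" and xy: "x \<in> carrier G" "y \<in> carrier G"
      by (auto simp: numeral_2_eq_2 length_Suc_conv)
    let ?u = "t x + t y + frag_cmul (int k) (frag_of [x, y])"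
    have u: "?u \<in> carrier (bar_chains G 2)"
      using xy t(1) by (simp add: bar_chains_closed)
    have "D #>\<^bsub>bar_chains G 2\<^esub> ?u = D #>\<^bsub>bar_chains G 2\<^esub> t (x \<otimes> y)"
      using s(2)[OF xy] xy t
      by (simp add: D.FactGroup_pow D.rcos_sum bar_chains_closed)
    then have "?u - t (x \<otimes> y) \<in> D"
      using bar_coset_eq_iff[OF D u] t(1) xy by simp
    then show ?case
      by (simp add: xs bar_boundary_2 T_def frag_extend_add frag_extend_diff algebra_simps)
  qed
  from this[of z] show ?thesis
    using z by (simp add: bar_cycles_2_iff T_def)
qed

lemma order_times_cycle:
  assumes "finite (carrier G)" "z \<in> bar_cycles G 2"
  shows "frag_cmul (int (order G)) z \<in> bar_boundaries G 2"
proof -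
  let ?D = "bar_boundaries G 2"
  have "comm_group (bar_chains G 2 Mod ?D)"
    by (intro comm_group.abelian_FactGroup comm_group_bar_chains subgroup_bar_boundaries_2)
  from two_coboundary_power_order[OF is_group assms(1) this universal_two_cocycle]
  show ?thesis
    using cycle_multiple_mem_if_coboundary subgroup_bar_boundaries_2 assms(2) by blast
qed

text \<open>If every cocycle with coefficients of exponent \<open>p\<close> splits, then in particular the universal cocycle
  modulo boundaries and \<open>p\<close>-fold chains does. Hence every cycle is a boundary plus \<open>p w\<close>, where \<open>w\<close>
  is itself a cycle because the 1-chains have no torsion: \<open>H\<^sub>2 = p H\<^sub>2\<close>.\<close>

lemma cycles_divisible_if_splits:
  assumes split: "\<And>A :: ('a list \<Rightarrow>\<^sub>0 int) set monoid. \<And>c. comm_group A \<Longrightarrow>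
      (\<And>a. a \<in> carrier A \<Longrightarrow> a [^]\<^bsub>A\<^esub> p = \<one>\<^bsub>A\<^esub>) \<Longrightarrow> two_cocycle G A c \<Longrightarrow> two_coboundary G A c"
    and p: "0 < (p::nat)" and z: "z \<in> bar_cycles G 2"
  obtains b w where "b \<in> bar_boundaries G 2" "w \<in> bar_cycles G 2" "z = b + frag_cmul (int p) w"
proof -
  interpret C: comm_group "bar_chains G 2" by (rule comm_group_bar_chains)
  interpret B: subgroup "bar_boundaries G 2" "bar_chains G 2" by (rule subgroup_bar_boundaries_2)
  define D where "D = {b + frag_cmul (int p) w | b w. b \<in> bar_boundaries G 2 \<and> w \<in> carrier (bar_chains G 2)}"
  have D: "subgroup D (bar_chains G 2)"
  proof (rule C.subgroupI)
    show "D \<subseteq> carrier (bar_chains G 2)"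
      using B.subset by (auto simp: D_def intro!: bar_chains_closed)
    show "D \<noteq> {}" using B.one_closed bar_chains_closed(1) by (auto simp: D_def)
    show "inv\<^bsub>bar_chains G 2\<^esub> u \<in> D" if u_mem: "u \<in> D" for u
    proof -
      obtain b w where u: "u = b + frag_cmul (int p) w" "b \<in> bar_boundaries G 2" "w \<in> carrier (bar_chains G 2)"
        using u_mem unfolding D_def by blast
      have "- b \<in> bar_boundaries G 2" "- w \<in> carrier (bar_chains G 2)"
        using u B.m_inv_closed[OF u(2)] B.subset C.inv_closed[OF u(3)] by auto
      moreover have "- u = - b + frag_cmul (int p) (- w)"
        by (rule poly_mapping_eqI) (simp add: u lookup_add lookup_minus)
      ultimately have "- u \<in> D" unfolding D_def by blast
      then show ?thesis using u_mem \<open>D \<subseteq> carrier (bar_chains G 2)\<close> by auto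
    qed
    show "u \<otimes>\<^bsub>bar_chains G 2\<^esub> v \<in> D" if uv: "u \<in> D" "v \<in> D" for u v
    proof -
      obtain b w b' w' where u: "u = b + frag_cmul (int p) w" "b \<in> bar_boundaries G 2" "w \<in> carrier (bar_chains G 2)"
        and v: "v = b' + frag_cmul (int p) w'" "b' \<in> bar_boundaries G 2" "w' \<in> carrier (bar_chains G 2)"
        using uv unfolding D_def by blast
      have "u + v = (b + b') + frag_cmul (int p) (w + w')"
        by (simp add: u v frag_cmul_distrib2 algebra_simps)
      then have "u + v \<in> D"
        using B.m_closed[OF u(2) v(2)] bar_chains_closed(2)[OF u(3) v(3)] unfolding D_def by auto
      then show ?thesis by simp
    qed
  qed
  interpret D: normal D "bar_chains G 2" using D by (simp add: C.normal_iff_subgroup)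
  have sub: "bar_boundaries G 2 \<subseteq> D"
  proof
    fix b assume "b \<in> bar_boundaries G 2"
    then show "b \<in> D"
      unfolding D_def mem_Collect_eq using bar_chains_closed(1)[of G 2]
      by (intro exI[of _ b] exI[of _ 0]) simp
  qed
  have pow: "a [^]\<^bsub>bar_chains G 2 Mod D\<^esub> p = \<one>\<^bsub>bar_chains G 2 Mod D\<^esub>"
    if a: "a \<in> carrier (bar_chains G 2 Mod D)" for a
  proof -
    obtain u where u: "u \<in> carrier (bar_chains G 2)" "a = D #>\<^bsub>bar_chains G 2\<^esub> u"
      using a by (auto simp: carrier_FactGroup)
    have "frag_cmul (int p) u \<in> D"
      unfolding D_def mem_Collect_eq using u B.one_closed
      by (intro exI[of _ 0] exI[of _ u]) simp
    then show ?thesis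
      using u C.coset_join2[OF _ D] D.subset by (auto simp: D.FactGroup_pow)
  qed
  have A: "comm_group (bar_chains G 2 Mod D)"
    using D by (rule C.abelian_FactGroup)
  interpret A: comm_group "bar_chains G 2 Mod D" by (rule A)
  note c = universal_two_cocycle[OF D sub]
  have "two_coboundary G (bar_chains G 2 Mod D)
      (\<lambda>x y. (D #>\<^bsub>bar_chains G 2\<^esub> frag_of [x, y]) [^]\<^bsub>bar_chains G 2 Mod D\<^esub> (1::nat))"
    using split[OF A pow c]
    by (simp only: two_coboundary_def A.nat_pow_eone two_cocycle_closed[OF c] cong: ball_cong)
  from cycle_multiple_mem_if_coboundary[OF D this z] have "z \<in> D" by simp
  then obtain b w where bw: "z = b + frag_cmul (int p) w" "b \<in> bar_boundaries G 2" "w \<in> carrier (bar_chains G 2)"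
    unfolding D_def by blast
  have "bar_boundary G b = 0" "bar_boundary G z = 0"
    using z bw bar_boundaries_2_subset by (auto simp: bar_cycles_2_iff)
  then have "frag_cmul (int p) (bar_boundary G w) = 0"
    using bw by (simp add: bar_boundary_add bar_boundary_cmul)
  then have "w \<in> bar_cycles G 2"
    using bw p by (simp add: bar_cycles_2_iff)
  with bw show thesis using that by blast
qed

end

section \<open>Finiteness of second homology\<close>

context group
begin

abbreviation bar_class :: "('a list \<Rightarrow>\<^sub>0 int) \<Rightarrow> ('a list \<Rightarrow>\<^sub>0 int) set" where
  "bar_class z \<equiv> bar_boundaries G 2 #>\<^bsub>bar_chains G 2\<^esub> z"

lemma comm_group_homology_2: "comm_group (group_homology 2 G)"
  and carrier_homology_2: "carrier (group_homology 2 G) = bar_class ` bar_cycles G 2"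
  and pow_homology_2: "z \<in> bar_cycles G 2 \<Longrightarrow>
    bar_class z [^]\<^bsub>group_homology 2 G\<^esub> (k::nat) = bar_class (frag_cmul (int k) z)"
proof -
  let ?Z = "(bar_chains G 2)\<lparr>carrier := bar_cycles G 2\<rparr>"
  interpret C: comm_group "bar_chains G 2" by (rule comm_group_bar_chains)
  have Z: "comm_group ?Z"
    by (rule group.group_comm_groupI[OF subgroup.subgroup_is_group[OF subgroup_bar_cycles_2 C.is_group]])
      (simp add: add.commute)
  interpret Z: comm_group ?Z by (rule Z)
  have B: "subgroup (bar_boundaries G 2) ?Z"
    using C.subgroup_incl[OF subgroup_bar_boundaries_2 subgroup_bar_cycles_2 bar_boundaries_2_subset] .
  interpret B: normal "bar_boundaries G 2" ?Z using B by (simp add: Z.normal_iff_subgroup)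
  have coset: "bar_boundaries G 2 #>\<^bsub>?Z\<^esub> z = bar_class z" for z
    by (simp add: r_coset_def)
  show "comm_group (group_homology 2 G)"
    using Z.abelian_FactGroup[OF B] by (simp add: group_homology_def)
  show "carrier (group_homology 2 G) = bar_class ` bar_cycles G 2"
    by (simp add: group_homology_def carrier_FactGroup coset)
  show "bar_class z [^]\<^bsub>group_homology 2 G\<^esub> (k::nat) = bar_class (frag_cmul (int k) z)"
    if "z \<in> bar_cycles G 2"
    using B.FactGroup_pow[of z k] that
    by (simp add: group_homology_def coset C.nat_pow_consistent[symmetric])
qed

text \<open>Let \<open>m\<close> be the order of the group. Two cycles whose coefficients agree modulo \<open>m\<close> differ by
  \<open>m\<close> times a cycle, which is a boundary. So a homology class depends only on finitely many residues
  modulo \<open>m\<close>.\<close>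

lemma finite_homology_2:
  assumes fin: "finite (carrier G)"
  shows "finite (carrier (group_homology 2 G))"
proof -
  let ?m = "order G" and ?X = "{xs. length xs = 2 \<and> set xs \<subseteq> carrier G}"
  have m: "0 < ?m" using fin by (simp add: order_gt_0_iff_finite)
  define r where "r z = restrict (\<lambda>xs. Poly_Mapping.lookup z xs mod int ?m) ?X" for z
  have X: "finite ?X"
    using finite_lists_length_eq[OF fin, of 2] by (simp add: conj_commute)
  have "r ` bar_cycles G 2 \<subseteq> ?X \<rightarrow>\<^sub>E {0..<int ?m}"
    using m
    unfolding r_def image_subset_iff restrict_PiE_iff
    by (intro ballI) (simp only: atLeastLessThan_iff pos_mod_sign pos_mod_bound of_nat_0_less_iff simp_thms)
  then have finr: "finite (r ` bar_cycles G 2)"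
    by (rule finite_subset) (rule finite_PiE[OF X], rule finite_atLeastLessThan_int)
  have same: "bar_class z = bar_class z'"
    if z: "z \<in> bar_cycles G 2" "z' \<in> bar_cycles G 2" and eq: "r z = r z'" for z z'
  proof -
    have zz: "z - z' \<in> carrier (bar_chains G 2)" "bar_boundary G (z - z') = 0"
      using z by (auto simp: bar_cycles_2_iff bar_boundary_diff bar_chains_closed)
    have "int ?m dvd Poly_Mapping.lookup (z - z') xs" for xs
    proof (cases "xs \<in> ?X")
      case True
      then have "Poly_Mapping.lookup z xs mod int ?m = Poly_Mapping.lookup z' xs mod int ?m"
        using fun_cong[OF eq, of xs] by (simp add: r_def)
      then show ?thesis by (simp add: lookup_minus mod_eq_dvd_iff)
    next
      case False
      then have "xs \<notin> Poly_Mapping.keys (z - z')" using zz by (auto simp: carrier_bar_chains)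
      then show ?thesis by (simp add: in_keys_iff)
    qed
    then obtain w where w: "z - z' = frag_cmul (int ?m) w" "Poly_Mapping.keys w \<subseteq> Poly_Mapping.keys (z - z')"
      using frag_divisible[OF m] by blast
    have "frag_cmul (int ?m) (bar_boundary G w) = 0"
      using zz w by (simp add: bar_boundary_cmul)
    then have "w \<in> bar_cycles G 2"
      using m zz(1) w(2) by (auto simp: bar_cycles_2_iff carrier_bar_chains)
    then have "z - z' \<in> bar_boundaries G 2"
      using order_times_cycle[OF fin] w(1) by simp
    then show ?thesis
      using bar_coset_eq_iff[OF subgroup_bar_boundaries_2] z by (simp add: bar_cycles_2_iff)
  qed
  have "bar_class ` bar_cycles G 2
      \<subseteq> (\<lambda>v. bar_class (inv_into (bar_cycles G 2) r v)) ` (r ` bar_cycles G 2)"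
  proof
    fix c assume "c \<in> bar_class ` bar_cycles G 2"
    then obtain z where z: "z \<in> bar_cycles G 2" "c = bar_class z" by blast
    then have "c = bar_class (inv_into (bar_cycles G 2) r (r z))"
      using same[OF z(1) inv_into_into[of "r z" r]] f_inv_into_f[of "r z" r] by simp
    then show "c \<in> (\<lambda>v. bar_class (inv_into (bar_cycles G 2) r v)) ` (r ` bar_cycles G 2)"
      using z by blast
  qed
  then show ?thesis
    unfolding carrier_homology_2 using finr finite_surj by blast
qed

end

section \<open>Second homology of an active sum\<close>

theorem corollary6:
  fixes G :: "('a, 'b) monoid_scheme" and \<F> :: "'a set set" and n :: nat
  assumes "group G" and "finite (carrier G)" and "0 < n"
    and "conj_closed_family G \<F>"
    and "\<And>F. F \<in> \<F> \<Longrightarrow> group_exponent (G\<lparr>carrier := F\<rparr>) dvd n"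
    and "infinite (UNIV :: 'u set)"
    and "\<And>F. F \<in> \<F> \<Longrightarrow> cellular TYPE('u) (integer_mod_group n) (G\<lparr>carrier := F\<rparr>)"
  shows "pi_group (group_homology 2 (active_sum G \<F>)) \<subseteq> prime_divisors n"
proof
  interpret conj_family G \<F>
    using assms(1,4) by (simp add: conj_family_def conj_family_axioms_def)
  let ?S = "active_sum G \<F>"
  fix p assume "p \<in> pi_group (group_homology 2 ?S)"
  then have p: "prime p" and p_dvd: "p dvd order (group_homology 2 ?S)"
    by (auto simp: pi_group_def prime_divisors_def)
  have finF: "finite F" if "F \<in> \<F>" for F
    using finite_subset[OF _ assms(2)] member_carrier[OF that] by blast
  have powF: "x [^]\<^bsub>G\<^esub> n = \<one>\<^bsub>G\<^esub>" if F: "F \<in> \<F>" "x \<in> F" for F x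
    using group.pow_eq_one_if_exponent_dvd[OF member_group[OF F(1)] _ assms(5)[OF F(1)], of x]
      finF[OF F(1)] F(2) by (simp add: nat_pow_consistent[symmetric])
  have finS: "finite (carrier ?S)"
    using finite_active_sum[OF assms(2,3) powF] .
  have "p dvd n"
  proof (rule ccontr)
    assume "\<not> p dvd n"
    then have cop: "coprime n p"
      using p prime_imp_coprime coprime_commute by blast
    have copF: "coprime (card F) p" if F: "F \<in> \<F>" for F
    proof -
      interpret F: group "G\<lparr>carrier := F\<rparr>" using F by (rule member_group)
      have "\<not> p dvd card F"
      proof
        assume "p dvd card F"
        then obtain x where x: "x \<in> F" "x \<noteq> \<one>\<^bsub>G\<^esub>" "x [^]\<^bsub>G\<lparr>carrier := F\<rparr>\<^esub> p = \<one>\<^bsub>G\<^esub>"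
          using F.exists_element_of_prime_order[OF _ p] finF[OF F] by (auto simp: order_def)
        then have "x [^]\<^bsub>G\<^esub> p = \<one>\<^bsub>G\<^esub>" by (simp add: nat_pow_consistent[symmetric])
        then have "group.ord G x dvd gcd n p"
          using powF[OF F x(1)] pow_eq_id member_carrier[OF F x(1)] by auto
        then have "group.ord G x = 1"
          using cop by (simp only: coprime_iff_gcd_eq_1 nat_dvd_1_iff_1)
        then show False using x ord_eq_1 member_carrier[OF F x(1)] by blast
      qed
      then show ?thesis using p prime_imp_coprime coprime_commute by blast
    qed
    have splits: "two_coboundary ?S A c"
      if "comm_group A" "\<And>a. a \<in> carrier A \<Longrightarrow> a [^]\<^bsub>A\<^esub> p = \<one>\<^bsub>A\<^esub>" "two_cocycle ?S A c"
      for A :: "(('a set \<times> 'a) list set set list \<Rightarrow>\<^sub>0 int) set monoid" and c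
      using cocycle_on_active_sum_splits[OF that(1,3,2) cop finF copF powF] .
    have "\<exists>Y\<in>carrier (group_homology 2 ?S). X = Y [^]\<^bsub>group_homology 2 ?S\<^esub> p"
      if X: "X \<in> carrier (group_homology 2 ?S)" for X
    proof -
      obtain z where z: "z \<in> bar_cycles ?S 2" "X = S.bar_class z"
        using X by (auto simp: S.carrier_homology_2)
      obtain b w where bw: "b \<in> bar_boundaries ?S 2" "w \<in> bar_cycles ?S 2" "z = b + frag_cmul (int p) w"
        using S.cycles_divisible_if_splits[OF splits prime_gt_0_nat[OF p] z(1)] .
      have "X = S.bar_class (frag_cmul (int p) w)"
        using z bw bar_coset_eq_iff[OF S.subgroup_bar_boundaries_2, of z "frag_cmul (int p) w"]
        by (simp add: bar_cycles_2_iff bar_chains_closed)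
      then show ?thesis
        using bw(2) by (auto simp: S.carrier_homology_2 S.pow_homology_2)
    qed
    then have "\<not> p dvd order (group_homology 2 ?S)"
      using group.prime_not_dvd_order_if_divisible[OF comm_group.axioms(2)[OF S.comm_group_homology_2]
          S.finite_homology_2[OF finS] p] by blast
    then show False using p_dvd by blast
  qed
  then show "p \<in> prime_divisors n" using p by (simp add: prime_divisors_def)
qed

end
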